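(* For each integer $n\ge2$ let $q_n(x,t)$ be the solution of $iq_t-(-i\partial_x)^nq=0$ with $$q(x,0)=\begin{cases}1,&|x|\le1,\\0,&\text{otherwise.}\end{cases}$$ Let $\mathfrak g=\frac1\pi\int_0^\pi\frac{\sin z}{z}\,dz-\frac12$. Then for any $\delta>0$ and for either choice of sign in $|x\pm1|\le\delta$, $$\lim_{n\to\infty}\lim_{t\downarrow0}\sup_{|x\pm1|\le\delta}\operatorname{Re}q_n(x,t)=1+\mathfrak g,\qquad \lim_{n\to\infty}\lim_{t\downarrow0}\inf_{|x\pm1|\le\delta}\operatorname{Re}q_n(x,t)=-\mathfrak g,$$ $$\lim_{n\to\infty}\lim_{t\downarrow0}\sup_{|x\pm1|\le\delta}\operatorname{Im}q_n(x,t)=0,\qquad \lim_{n\to\infty}\lim_{t\downarrow0}\inf_{|x\pm1|\le\delta}\operatorname{Im}q_n(x,t)=0.$$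
   Context: The solution is the $L^2$ solution $q_n(x,t)=\frac1{2\pi}\int_{\mathbb R}e^{ikx-ik^nt}\,\hat q_o(k)\,dk$, where $q_o$ is the given initial condition and $\hat q_o(k)=\int_{\mathbb R}e^{-ikx}q_o(x)\,dx$; for $t>0$ the continuous representative of $q_n(\cdot,t)$ is used. *)

theory Defs
  imports "HOL-Analysis.Analysis"
begin

definition fourier_transform :: "(real \<Rightarrow> complex) \<Rightarrow> real \<Rightarrow> complex" where
  "fourier_transform f k = (LINT x|lborel. cis (- (k * x)) * f x)"

definition truncated_solution ::
  "nat \<Rightarrow> (real \<Rightarrow> complex) \<Rightarrow> real \<Rightarrow> real \<Rightarrow> real \<Rightarrow> complex" where
  "truncated_solution n q\<^sub>o R x t =
     1 / (2 * of_real pi) *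
     (LINT k:{-R..R}|lborel. cis (k * x - k ^ n * t) * fourier_transform q\<^sub>o k)"

text \<open>
  The \<open>L\<^sup>2\<close> solution of \<open>i q_t - (-i d/dx)^n q = 0\<close> with initial datum \<open>q\<^sub>o\<close> (in \<open>L\<^sup>1 \<inter> L\<^sup>2\<close>).
  The inverse Fourier integral over the real line need not converge absolutely; it is read in the
  Plancherel sense, as the \<open>L\<^sup>2(dx)\<close> limit of the integrals over \<open>[-R, R]\<close>.  The squared distance
  is an \<open>ennreal\<close> integral, so that a non-integrable difference does not count as distance 0.
  For \<open>t > 0\<close>, continuity in \<open>x\<close> selects a unique function in the \<open>L\<^sup>2\<close> class.
\<close>

definition L2_solution ::
  "nat \<Rightarrow> (real \<Rightarrow> complex) \<Rightarrow> (real \<Rightarrow> real \<Rightarrow> complex) \<Rightarrow> bool" where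
  "L2_solution n q\<^sub>o q \<longleftrightarrow>
     (\<forall>x. q x 0 = q\<^sub>o x) \<and>
     (\<forall>t>0. continuous_on UNIV (\<lambda>x. q x t) \<and>
            integrable lborel (\<lambda>x. (cmod (q x t))\<^sup>2) \<and>
            ((\<lambda>R. \<integral>\<^sup>+x. ennreal ((cmod (q x t - truncated_solution n q\<^sub>o R x t))\<^sup>2) \<partial>lborel)
               \<longlongrightarrow> 0) at_top)"

definition box_datum :: "real \<Rightarrow> complex" where
  "box_datum x = (if \<bar>x\<bar> \<le> 1 then 1 else 0)"

definition gibbs_constant :: real where
  "gibbs_constant = 1 / pi * (LBINT z=0..pi. sin z / z) - 1 / 2"

text \<open>
  \<open>lim (n \<rightarrow> \<infinity>) lim (t \<down> 0) F n t = l\<close>, including the existence of the inner limit for every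
  \<open>n \<ge> 2\<close>.
\<close>

definition has_iterated_limit :: "(nat \<Rightarrow> real \<Rightarrow> real) \<Rightarrow> real \<Rightarrow> bool" where
  "has_iterated_limit F l \<longleftrightarrow>
     (\<exists>L. (\<forall>n\<ge>2. (F n \<longlongrightarrow> L n) (at_right 0)) \<and> L \<longlonglongrightarrow> l)"

end

theory Submission
  imports Defs "HOL-Probability.Sinc_Integral" "HOL-Real_Asymp.Real_Asymp"
begin

text \<open>
  With \<open>s = t\<^sup>1\<^sup>/\<^sup>n\<close> the solution is \<open>F\<^sub>n ((x + 1) / s) - F\<^sub>n ((x - 1) / s)\<close>, where \<open>F\<^sub>n y\<close> is
  \<open>1 / (2 \<pi>)\<close> times the principal value of \<open>\<integral> cis (k y - k\<^sup>n) / (\<i> k) dk\<close>, a continuous function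
  with limits \<open>\<plusminus>1/2\<close> at \<open>\<plusminus>\<infinity>\<close>.  As \<open>t \<down> 0\<close> the jumps separate, so the extrema over the interval
  converge to extrema of the profile \<open>F\<^sub>n\<close>.  Finally \<open>F\<^sub>n \<rightarrow> Si / \<pi>\<close> uniformly: for \<open>\<bar>k\<bar> < 1\<close> the
  factor \<open>cis (- k\<^sup>n)\<close> tends to 1, while for \<open>\<bar>k\<bar> > 1\<close> the phase has second derivative of size at
  least \<open>n (n - 1)\<close>, and van der Corput's lemma bounds the integral by \<open>O(1/n)\<close> uniformly in \<open>y\<close>.
  The extrema of \<open>Si\<close> are attained at \<open>\<plusminus>\<pi>\<close>.
\<close>

section \<open>Oscillatory integrals and the sine integral\<close>

lemma has_vector_derivative_cis:
  assumes "(f has_real_derivative d) (at x within A)"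
  shows "((\<lambda>x. cis (f x)) has_vector_derivative (d *\<^sub>R (\<i> * cis (f x)))) (at x within A)"
proof -
  have "((\<lambda>x. cis (f x)) has_derivative (\<lambda>t. (t * d) *\<^sub>R (\<i> * cis (f x)))) (at x within A)"
    using assms by (intro has_derivative_cis) (simp add: has_field_derivative_def mult_commute_abs)
  then show ?thesis
    by (simp add: has_vector_derivative_def)
qed

lemma norm_cis_diff_le: "cmod (cis a - cis b) \<le> \<bar>a - b\<bar>"
proof -
  have "cis a - cis b = cis b * (exp (\<i> * of_real (a - b)) - 1)"
    by (simp add: right_diff_distrib cis_mult flip: cis_conv_exp of_real_diff)
  then have "cmod (cis a - cis b) = 2 * \<bar>sin ((a - b) / 2)\<bar>"
    by (simp add: norm_mult dist_exp_i_1 del: of_real_diff)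
  also have "\<dots> \<le> \<bar>a - b\<bar>"
    using abs_sin_x_le_abs_x[of "(a - b) / 2"] by simp
  finally show ?thesis .
qed

text \<open>Integration by parts against \<open>- \<i> w cis \<phi>\<close>, whose derivative is \<open>(w p - \<i> w') cis \<phi>\<close>.\<close>

lemma oscillatory_integral_bound:
  fixes \<phi> p \<psi> w w' G G' :: "real \<Rightarrow> real"
  assumes ab: "a \<le> b"
    and \<phi>: "\<And>x. x \<in> {a..b} \<Longrightarrow> (\<phi> has_real_derivative p x) (at x within {a..b})"
    and w: "\<And>x. x \<in> {a..b} \<Longrightarrow> (w has_real_derivative w' x) (at x within {a..b})"
    and G: "\<And>x. x \<in> {a..b} \<Longrightarrow> (G has_real_derivative G' x) (at x within {a..b})"
    and \<psi>: "continuous_on {a..b} \<psi>"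
    and le: "\<And>x. x \<in> {a..b} \<Longrightarrow> \<bar>\<psi> x - w x * p x\<bar> + \<bar>w' x\<bar> \<le> G' x"
  shows "cmod (integral {a..b} (\<lambda>x. \<psi> x *\<^sub>R cis (\<phi> x))) \<le> \<bar>w a\<bar> + \<bar>w b\<bar> + (G b - G a)"
proof -
  let ?f = "\<lambda>x. \<psi> x *\<^sub>R cis (\<phi> x)"
  let ?W = "\<lambda>x. w x *\<^sub>R (- \<i> * cis (\<phi> x))"
  let ?W' = "\<lambda>x. w x *\<^sub>R (- \<i> * (p x *\<^sub>R (\<i> * cis (\<phi> x)))) + w' x *\<^sub>R (- \<i> * cis (\<phi> x))"
  have cont: "continuous_on {a..b} \<phi>"
    using \<phi> by (meson DERIV_continuous_on)
  have f: "?f integrable_on {a..b}"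
    by (intro integrable_continuous_real continuous_intros \<psi> cont)
  have "(?W has_vector_derivative ?W' x) (at x within {a..b})" if "x \<in> {a..b}" for x
    by (intro has_vector_derivative_scaleR w that has_vector_derivative_mult_right
        has_vector_derivative_cis \<phi>)
  then have W: "(?W' has_integral ?W b - ?W a) {a..b}"
    by (intro fundamental_theorem_of_calculus ab)
  have G'': "(G' has_integral G b - G a) {a..b}"
    by (intro fundamental_theorem_of_calculus ab)
       (use G in \<open>simp add: has_real_derivative_iff_has_vector_derivative\<close>)
  have norm_le: "cmod (?f x - ?W' x) \<le> G' x" if "x \<in> {a..b}" for x
  proof -
    have "?f x - ?W' x = (of_real (\<psi> x - w x * p x) + \<i> * of_real (w' x)) * cis (\<phi> x)"
      by (simp add: scaleR_conv_of_real algebra_simps)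
    then have "cmod (?f x - ?W' x) \<le> cmod (of_real (\<psi> x - w x * p x)) + cmod (\<i> * of_real (w' x))"
      by (metis norm_mult norm_cis mult.right_neutral norm_triangle_ineq)
    also have "\<dots> = \<bar>\<psi> x - w x * p x\<bar> + \<bar>w' x\<bar>"
      by (simp add: norm_mult del: of_real_diff of_real_mult)
    finally show ?thesis using le[OF that] by linarith
  qed
  have "cmod (integral {a..b} (\<lambda>x. ?f x - ?W' x)) \<le> integral {a..b} G'"
    using f W G'' by (intro Henstock_Kurzweil_Integration.integral_norm_bound_integral norm_le integrable_diff)
                     (auto simp: has_integral_iff)
  also have "integral {a..b} (\<lambda>x. ?f x - ?W' x) = integral {a..b} ?f - (?W b - ?W a)"
    using Henstock_Kurzweil_Integration.integral_diff[OF f has_integral_integrable[OF W]]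
    by (simp only: integral_unique[OF W])
  finally have "cmod (integral {a..b} ?f - (?W b - ?W a)) \<le> G b - G a"
    using G'' by (simp add: has_integral_iff)
  moreover have "cmod (?W b - ?W a) \<le> \<bar>w a\<bar> + \<bar>w b\<bar>"
    using norm_triangle_ineq4[of "?W b" "?W a"] by (simp add: norm_mult)
  ultimately show ?thesis
    using norm_triangle_sub[of "integral {a..b} ?f" "?W b - ?W a"] by linarith
qed

text \<open>
  The weight \<open>w = \<psi> p / (p\<^sup>2 + \<mu>\<^sup>2)\<close> is a smooth substitute for \<open>\<psi> / p\<close>, so that no neighbourhood
  of the stationary point has to be cut out.
\<close>

lemma van_der_Corput_second_derivative:
  fixes \<phi> p p' \<psi> \<psi>' :: "real \<Rightarrow> real"
  assumes ab: "a \<le> b" and "\<mu> > 0" and "l > 0"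
    and \<phi>: "\<And>x. x \<in> {a..b} \<Longrightarrow> (\<phi> has_real_derivative p x) (at x within {a..b})"
    and p: "\<And>x. x \<in> {a..b} \<Longrightarrow> (p has_real_derivative p' x) (at x within {a..b})"
    and p': "\<And>x. x \<in> {a..b} \<Longrightarrow> l \<le> p' x"
    and \<psi>: "\<And>x. x \<in> {a..b} \<Longrightarrow> (\<psi> has_real_derivative \<psi>' x) (at x within {a..b})"
    and \<psi>': "\<And>x. x \<in> {a..b} \<Longrightarrow> \<psi>' x \<le> 0"
    and bounds: "\<And>x. x \<in> {a..b} \<Longrightarrow> 0 \<le> \<psi> x \<and> \<psi> x \<le> c"
  shows "cmod (integral {a..b} (\<lambda>x. \<psi> x *\<^sub>R cis (\<phi> x))) \<le> c * (3 / (2 * \<mu>) + pi / \<mu> + pi * \<mu> / l)"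
proof -
  define D where "D x = (p x)\<^sup>2 + \<mu>\<^sup>2" for x
  have D: "D x > 0" for x
    using \<open>\<mu> > 0\<close> by (simp add: D_def add_nonneg_pos)
  have pD: "\<bar>p x\<bar> / D x \<le> 1 / (2 * \<mu>)" for x
  proof -
    have "0 \<le> (\<bar>p x\<bar> - \<mu>)\<^sup>2" by simp
    then have "2 * \<mu> * \<bar>p x\<bar> \<le> D x"
      by (simp add: D_def power2_eq_square algebra_simps)
    then show ?thesis
      using D[of x] \<open>\<mu> > 0\<close> by (simp add: field_simps)
  qed
  define w where "w x = \<psi> x * p x / D x" for x
  define w' where "w' x = \<psi>' x * (p x / D x) + \<psi> x * (p' x * (\<mu>\<^sup>2 - (p x)\<^sup>2) / (D x)\<^sup>2)" for x
  \<comment> \<open>\<open>K\<close> multiplies \<open>\<mu> * p' x / D x\<close>, the derivative of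
    \<open>arctan (p x / \<mu>)\<close>. The summand \<open>\<mu> / l\<close> pays for
    \<open>\<psi> - w * p\<close> and \<open>1 / \<mu>\<close> for the part of \<open>w'\<close>
    that contains \<open>p'\<close>. The part with \<open>\<psi>'\<close> is absorbed by
    \<open>- \<psi> / (2 * \<mu>)\<close>. As \<open>arctan\<close> varies by at most \<pi>, the
    bound for \<open>G b - G a\<close> does not see the length of the interval.\<close>
  define K where "K = c * (1 / \<mu> + \<mu> / l)"
  define G where "G x = - \<psi> x / (2 * \<mu>) + K * arctan (p x / \<mu>)" for x
  define G' where "G' x = - \<psi>' x / (2 * \<mu>) + K * (\<mu> * p' x / D x)" for x
  have a: "a \<in> {a..b}" and b: "b \<in> {a..b}" using ab by auto
  have c: "c \<ge> 0" using bounds[OF a] by linarith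
  have "K \<ge> 0" using c \<open>\<mu> > 0\<close> \<open>l > 0\<close> by (simp add: K_def)
  have w_le: "\<bar>w x\<bar> \<le> c * (1 / (2 * \<mu>))" if "x \<in> {a..b}" for x
  proof -
    have "\<bar>w x\<bar> = \<psi> x * (\<bar>p x\<bar> / D x)"
      using bounds[OF that] D[of x] by (simp add: w_def abs_mult)
    also have "\<dots> \<le> c * (1 / (2 * \<mu>))"
      using bounds[OF that] pD[of x] D[of x] c by (intro mult_mono) auto
    finally show ?thesis .
  qed
  have "cmod (integral {a..b} (\<lambda>x. \<psi> x *\<^sub>R cis (\<phi> x))) \<le> \<bar>w a\<bar> + \<bar>w b\<bar> + (G b - G a)"
  proof (rule oscillatory_integral_bound[OF ab \<phi>, where w' = w' and G' = G'])
    fix x assume x: "x \<in> {a..b}"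
    have dD: "(D has_real_derivative 2 * p x * p' x) (at x within {a..b})"
      unfolding D_def by (rule derivative_eq_intros p x refl | simp)+
    show "(w has_real_derivative w' x) (at x within {a..b})"
      unfolding w_def
      by (rule derivative_eq_intros p dD \<psi> x refl | use D[of x] in \<open>simp; fail\<close>)+
         (use D[of x] in \<open>simp add: w'_def field_simps power2_eq_square\<close>,
          simp add: D_def algebra_simps power2_eq_square)
    show "(G has_real_derivative G' x) (at x within {a..b})"
      unfolding G_def
      by (rule derivative_eq_intros p \<psi> x refl | use \<open>\<mu> > 0\<close> in \<open>simp; fail\<close>)+
         (use \<open>\<mu> > 0\<close> in \<open>simp add: G'_def D_def field_simps power2_eq_square\<close>)
    have pp: "p' x > 0" using p'[OF x] \<open>l > 0\<close> by linarith
    have "\<psi> x - w x * p x = \<psi> x * (\<mu>\<^sup>2 / D x)"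
      using D[of x] by (simp add: w_def field_simps) (simp add: D_def algebra_simps power2_eq_square)
    then have "\<bar>\<psi> x - w x * p x\<bar> = \<psi> x * (\<mu>\<^sup>2 / D x)"
      using bounds[OF x] D[of x] by (simp add: abs_mult)
    \<comment> \<open>Inserting the factor \<open>p' x / l\<close>, which is at least 1, makes the
      term a multiple of the derivative of \<open>arctan (p x / \<mu>)\<close>. This is where the
      lower bound on the second derivative of the phase enters.\<close>
    also have "\<dots> \<le> c * (\<mu>\<^sup>2 / D x * (p' x / l))"
    proof (intro mult_mono)
      have "\<mu>\<^sup>2 / D x * 1 \<le> \<mu>\<^sup>2 / D x * (p' x / l)"
        using p'[OF x] \<open>l > 0\<close> D[of x] by (intro mult_left_mono) auto
      then show "\<mu>\<^sup>2 / D x \<le> \<mu>\<^sup>2 / D x * (p' x / l)" by simp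
    qed (use bounds[OF x] c D[of x] in auto)
    finally have 1: "\<bar>\<psi> x - w x * p x\<bar> \<le> c * (\<mu> / l) * (\<mu> * p' x / D x)"
      by (simp add: power2_eq_square mult_ac)
    have "\<bar>\<psi>' x * (p x / D x)\<bar> = - \<psi>' x * (\<bar>p x\<bar> / D x)"
      using \<psi>'[OF x] D[of x] by (simp add: abs_mult)
    also have "\<dots> \<le> - \<psi>' x * (1 / (2 * \<mu>))"
      using \<psi>'[OF x] pD[of x] by (intro mult_left_mono) auto
    finally have 2: "\<bar>\<psi>' x * (p x / D x)\<bar> \<le> - \<psi>' x / (2 * \<mu>)" by simp
    have "\<bar>\<mu>\<^sup>2 - (p x)\<^sup>2\<bar> \<le> D x"
      by (simp add: D_def abs_le_iff)
    then have "p' x * \<bar>\<mu>\<^sup>2 - (p x)\<^sup>2\<bar> / (D x)\<^sup>2 \<le> p' x * D x / (D x)\<^sup>2"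
      using pp by (intro divide_right_mono mult_left_mono) auto
    also have "\<dots> = p' x / D x" using D[of x] by (simp add: power2_eq_square)
    finally have "\<bar>p' x * (\<mu>\<^sup>2 - (p x)\<^sup>2) / (D x)\<^sup>2\<bar> \<le> p' x / D x"
      using pp by (simp add: abs_mult)
    then have "\<bar>\<psi> x * (p' x * (\<mu>\<^sup>2 - (p x)\<^sup>2) / (D x)\<^sup>2)\<bar> \<le> c * (p' x / D x)"
      unfolding abs_mult[of "\<psi> x"] using bounds[OF x] c by (intro mult_mono) auto
    also have "\<dots> = c * (1 / \<mu>) * (\<mu> * p' x / D x)"
      using \<open>\<mu> > 0\<close> by simp
    finally have 3: "\<bar>\<psi> x * (p' x * (\<mu>\<^sup>2 - (p x)\<^sup>2) / (D x)\<^sup>2)\<bar> \<le> c * (1 / \<mu>) * (\<mu> * p' x / D x)" .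
    have "\<bar>\<psi> x - w x * p x\<bar> + \<bar>w' x\<bar>
        \<le> c * (\<mu> / l) * (\<mu> * p' x / D x) + (- \<psi>' x / (2 * \<mu>) + c * (1 / \<mu>) * (\<mu> * p' x / D x))"
      unfolding w'_def by (intro add_mono 1 order_trans[OF abs_triangle_ineq] 2 3)
    also have "\<dots> = G' x"
      unfolding G'_def K_def by (simp only: ring_distribs ac_simps)
    finally show "\<bar>\<psi> x - w x * p x\<bar> + \<bar>w' x\<bar> \<le> G' x" .
  next
    show "continuous_on {a..b} \<psi>"
      using \<psi> by (meson DERIV_continuous_on)
  qed
  also have "\<dots> \<le> c / \<mu> + (c / (2 * \<mu>) + K * pi)"
  proof -
    have "K * arctan (p b / \<mu>) \<le> K * (pi / 2)" "K * arctan (p a / \<mu>) \<ge> K * (- (pi / 2))"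
      using arctan_ubound[of "p b / \<mu>"] arctan_lbound[of "p a / \<mu>"] \<open>K \<ge> 0\<close>
      by (intro mult_left_mono; simp)+
    moreover have "\<psi> a / (2 * \<mu>) \<le> c / (2 * \<mu>)" "\<psi> b / (2 * \<mu>) \<ge> 0"
      using bounds[OF a] bounds[OF b] \<open>\<mu> > 0\<close> by (auto intro: divide_right_mono)
    ultimately have "G b - G a \<le> c / (2 * \<mu>) + K * pi"
      unfolding G_def by simp
    moreover have "c / \<mu> = 2 * (c * (1 / (2 * \<mu>)))" by simp
    ultimately show ?thesis
      using w_le[OF a] w_le[OF b] by linarith
  qed
  also have "\<dots> = c * (3 / (2 * \<mu>) + pi / \<mu> + pi * \<mu> / l)"
    using \<open>\<mu> > 0\<close> \<open>l > 0\<close> by (simp add: K_def field_simps)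
  finally show ?thesis .
qed

section \<open>Extrema and limits of the sine integral\<close>

lemma Si_0 [simp]: "Si 0 = 0"
  using Si_neg[of 0] by simp

lemma Si_minus: "Si (- x) = - Si x"
  using Si_neg[of x] Si_neg[of "- x"] by (cases "x \<ge> 0") auto

lemma Si_nonneg:
  assumes "0 \<le> x" "x \<le> pi"
  shows "0 \<le> Si x" "Si x \<le> Si pi"
proof -
  have "Si y \<le> Si z" if "0 \<le> y" "y \<le> z" "z \<le> pi" for y z
  proof (rule DERIV_nonneg_imp_nondecreasing[OF that(2)])
    fix u assume "y \<le> u" "u \<le> z"
    with that show "\<exists>d. (Si has_real_derivative d) (at u) \<and> 0 \<le> d"
      by (intro exI[of _ "sinc u"] conjI DERIV_Si) (auto intro!: divide_nonneg_nonneg sin_ge_zero)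
  qed
  from this[of 0 x] this[of x pi] assms show "0 \<le> Si x" "Si x \<le> Si pi" by auto
qed

text \<open>Beyond \<open>\<pi>\<close>, \<open>Si z + (1 + cos z) / z\<close> decreases and \<open>Si z - (1 - cos z) / z\<close> increases.\<close>

lemma abs_Si_le: "\<bar>Si x\<bar> \<le> Si pi"
proof -
  have *: "\<bar>Si x\<bar> \<le> Si pi" if "x > pi" for x
  proof -
    have x: "x > 0" using that pi_gt_zero by linarith
    have "Si x + (1 + cos x) / x \<le> Si pi + (1 + cos pi) / pi"
    proof (rule DERIV_nonpos_imp_nonincreasing[where f = "\<lambda>z. Si z + (1 + cos z) / z"])
      fix u assume "pi \<le> u" "u \<le> x"
      then have u: "u > 0" using pi_gt_zero by linarith
      then show "\<exists>d. ((\<lambda>z. Si z + (1 + cos z) / z) has_real_derivative d) (at u) \<and> d \<le> 0"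
        using cos_ge_minus_one[of u]
        by (intro exI[of _ "- (1 + cos u) / u\<^sup>2"] conjI)
           (auto intro!: derivative_eq_intros DERIV_Si divide_nonpos_nonneg simp: field_simps power2_eq_square)
    qed (use that in simp)
    moreover have "(1 + cos x) / x \<ge> 0" using x cos_ge_minus_one[of x] by (intro divide_nonneg_pos) linarith+
    ultimately have 1: "Si x \<le> Si pi" by simp
    \<comment> \<open>The derivative of \<open>z * Si z - (1 - cos z)\<close> is
      \<open>Si z\<close>, which is nonnegative on the interval from 0 to \<pi>. The result is
      \<open>Si pi \<ge> 2 / pi\<close>, the starting value that keeps the increasing lower
      comparison function nonnegative beyond \<pi>.\<close>
    have "pi * Si pi - (1 - cos pi) \<ge> 0 * Si 0 - (1 - cos 0)"
    proof (rule DERIV_nonneg_imp_nondecreasing[where f = "\<lambda>z. z * Si z - (1 - cos z)"])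
      fix u assume "0 \<le> u" "u \<le> pi"
      then show "\<exists>d. ((\<lambda>z. z * Si z - (1 - cos z)) has_real_derivative d) (at u) \<and> 0 \<le> d"
        by (intro exI[of _ "Si u"] conjI Si_nonneg)
           (auto intro!: derivative_eq_intros DERIV_Si)
    qed simp
    then have "Si pi - 2 / pi \<ge> 0" by (simp add: field_simps)
    moreover have "Si x - (1 - cos x) / x \<ge> Si pi - (1 - cos pi) / pi"
    proof (rule DERIV_nonneg_imp_nondecreasing[where f = "\<lambda>z. Si z - (1 - cos z) / z"])
      fix u assume "pi \<le> u" "u \<le> x"
      then have u: "u > 0" using pi_gt_zero by linarith
      then show "\<exists>d. ((\<lambda>z. Si z - (1 - cos z) / z) has_real_derivative d) (at u) \<and> 0 \<le> d"
        by (intro exI[of _ "(1 - cos u) / u\<^sup>2"] conjI)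
           (auto intro!: derivative_eq_intros DERIV_Si simp: field_simps power2_eq_square)
    qed (use that in simp)
    moreover have "(1 - cos x) / x \<ge> 0" using x by simp
    ultimately have "Si x \<ge> 0" by simp
    with 1 show ?thesis by simp
  qed
  have "\<bar>Si x\<bar> \<le> Si pi" if "x \<ge> 0" for x
    using that *[of x] Si_nonneg[of x] by (cases "x \<le> pi") auto
  from this[of x] this[of "- x"] show ?thesis by (cases "x \<ge> 0") (auto simp: Si_minus)
qed

lemma Si_at_bot: "(Si \<longlongrightarrow> - (pi / 2)) at_bot"
  using tendsto_minus[OF Si_at_top] by (simp add: filterlim_at_bot_mirror Si_minus)

section \<open>The truncated profile of a single jump\<close>

text \<open>
  The contributions of \<open>k\<close> and \<open>- k\<close> to the principal value integral are added up, so that the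
  singularity at \<open>k = 0\<close> becomes removable (the kernel has the junk value 0 there).
\<close>

definition wave_kernel :: "nat \<Rightarrow> real \<Rightarrow> real \<Rightarrow> real \<Rightarrow> complex" where
  "wave_kernel n t y k =
     (cis (k * y - k ^ n * t) - cis (- (k * y) - (- k) ^ n * t)) / (\<i> * of_real k)"

definition truncated_front :: "nat \<Rightarrow> real \<Rightarrow> real \<Rightarrow> real \<Rightarrow> complex" where
  "truncated_front n t R y = integral {0..R} (wave_kernel n t y) / (2 * of_real pi)"

definition front :: "nat \<Rightarrow> real \<Rightarrow> complex" where
  "front n y = lim (\<lambda>m. truncated_front n 1 (real m) y)"

text \<open>Both phases contain a factor \<open>k\<close>, and \<open>cis\<close> is 1-Lipschitz, so
  the division by \<open>k\<close> is compensated. This one estimate gives boundedness near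
  \<open>k = 0\<close> (by comparison with the zero kernel), Lipschitz continuity in
  \<open>y\<close>, and the cost of replacing time 1 by time 0.\<close>

lemma norm_wave_kernel_diff_le:
  assumes "n \<ge> 1"
  shows "cmod (wave_kernel n t y k - wave_kernel n t' y' k)
           \<le> 2 * (\<bar>y - y'\<bar> + \<bar>k\<bar> ^ (n - 1) * \<bar>t - t'\<bar>)"
proof (cases "k = 0")
  case True
  then show ?thesis by (simp add: wave_kernel_def)
next
  case False
  let ?E = "\<lambda>t y. cis (k * y - k ^ n * t) - cis (- (k * y) - (- k) ^ n * t)"
  have n: "n = Suc (n - 1)" using assms by simp
  have "cmod (?E t y - ?E t' y') \<le>
      cmod (cis (k * y - k ^ n * t) - cis (k * y' - k ^ n * t')) +
      cmod (cis (- (k * y) - (- k) ^ n * t) - cis (- (k * y') - (- k) ^ n * t'))"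
    by norm
  also have "\<dots> \<le> \<bar>(k * y - k ^ n * t) - (k * y' - k ^ n * t')\<bar> +
      \<bar>(- (k * y) - (- k) ^ n * t) - (- (k * y') - (- k) ^ n * t')\<bar>"
    by (intro add_mono norm_cis_diff_le)
  also have "\<dots> = \<bar>k * (y - y') - k ^ n * (t - t')\<bar> + \<bar>- (k * (y - y')) - (- k) ^ n * (t - t')\<bar>"
    by (simp add: algebra_simps)
  also have "\<dots> \<le> 2 * (\<bar>k * (y - y')\<bar> + \<bar>k ^ n * (t - t')\<bar>)"
    using abs_triangle_ineq4[of "k * (y - y')" "k ^ n * (t - t')"]
      abs_triangle_ineq4[of "- (k * (y - y'))" "(- k) ^ n * (t - t')"]
    by (simp add: abs_mult power_abs)
  also have "\<dots> = \<bar>k\<bar> * (2 * (\<bar>y - y'\<bar> + \<bar>k\<bar> ^ (n - 1) * \<bar>t - t'\<bar>))"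
  proof -
    have "\<bar>k ^ n\<bar> = \<bar>k\<bar> * \<bar>k\<bar> ^ (n - 1)"
      by (metis n power_abs power_Suc)
    then show ?thesis by (simp only: abs_mult abs_minus_commute right_diff_distrib[symmetric]) (simp add: algebra_simps)
  qed
  finally have le: "cmod (?E t y - ?E t' y') \<le> \<bar>k\<bar> * (2 * (\<bar>y - y'\<bar> + \<bar>k\<bar> ^ (n - 1) * \<bar>t - t'\<bar>))" .
  have "wave_kernel n t y k - wave_kernel n t' y' k = (?E t y - ?E t' y') / (\<i> * of_real k)"
    unfolding wave_kernel_def by (simp add: diff_divide_distrib)
  then have "cmod (wave_kernel n t y k - wave_kernel n t' y' k) = cmod (?E t y - ?E t' y') / \<bar>k\<bar>"
    by (simp add: norm_divide norm_mult)
  then show ?thesis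
    using le False by (simp add: divide_le_eq mult.commute)
qed

lemma wave_kernel_0 [simp]: "wave_kernel n 0 0 k = 0"
  by (simp add: wave_kernel_def)

lemma norm_wave_kernel_le:
  "n \<ge> 1 \<Longrightarrow> cmod (wave_kernel n t y k) \<le> 2 * (\<bar>y\<bar> + \<bar>k\<bar> ^ (n - 1) * \<bar>t\<bar>)"
  using norm_wave_kernel_diff_le[of n t y k 0 0] by simp

lemma borel_measurable_wave_kernel [measurable]: "wave_kernel n t y \<in> borel_measurable borel"
proof -
  have "(\<lambda>k. cis (k * y - k ^ n * t) - cis (- (k * y) - (- k) ^ n * t)) \<in> borel_measurable borel"
    by (intro borel_measurable_continuous_onI continuous_intros)
  then show ?thesis unfolding wave_kernel_def by measurable
qed

text \<open>The value 0 at \<open>k = 0\<close> can break continuity there, so the argument rests on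
  measurability and boundedness.\<close>

lemma wave_kernel_integrable:
  assumes "n \<ge> 1"
  shows "wave_kernel n t y integrable_on {a..b}"
proof -
  define B where "B = 2 * (\<bar>y\<bar> + (max \<bar>a\<bar> \<bar>b\<bar>) ^ (n - 1) * \<bar>t\<bar>)"
  have "cmod (wave_kernel n t y k) \<le> B" if "k \<in> {a..b}" for k
  proof -
    have "\<bar>k\<bar> ^ (n - 1) \<le> (max \<bar>a\<bar> \<bar>b\<bar>) ^ (n - 1)"
      using that by (intro power_mono) auto
    then have "\<bar>k\<bar> ^ (n - 1) * \<bar>t\<bar> \<le> (max \<bar>a\<bar> \<bar>b\<bar>) ^ (n - 1) * \<bar>t\<bar>"
      by (intro mult_right_mono) auto
    then show ?thesis
      unfolding B_def by (intro order_trans[OF norm_wave_kernel_le[OF assms]]) simp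
  qed
  then have "set_integrable lborel {a..b} (wave_kernel n t y)"
    unfolding set_integrable_def
    by (intro integrableI_bounded_set_indicator[where B = B]) (auto simp: emeasure_lborel_Icc_eq)
  then show ?thesis by (rule set_borel_integral_eq_integral)
qed

lemma truncated_front_diff:
  assumes "n \<ge> 1" "0 \<le> r" "r \<le> R"
  shows "truncated_front n t R y - truncated_front n t r y =
           integral {r..R} (wave_kernel n t y) / (2 * of_real pi)"
  using Henstock_Kurzweil_Integration.integral_combine[OF assms(2,3) wave_kernel_integrable[OF assms(1), of t y]]
  by (simp add: truncated_front_def add_divide_distrib[symmetric] diff_divide_distrib[symmetric])
     (metis add_diff_cancel_left')

lemma truncated_front_Lipschitz:
  assumes "n \<ge> 1" "R \<ge> 0"
  shows "cmod (truncated_front n t R y - truncated_front n t R z) \<le> R * \<bar>y - z\<bar>"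
proof -
  note int = wave_kernel_integrable[OF assms(1), of t _ 0 R]
  have "truncated_front n t R y - truncated_front n t R z =
      integral {0..R} (\<lambda>k. wave_kernel n t y k - wave_kernel n t z k) / (2 * of_real pi)"
    unfolding truncated_front_def
    by (simp add: Henstock_Kurzweil_Integration.integral_diff[OF int int] diff_divide_distrib)
  also have "cmod \<dots> = cmod (integral {0..R} (\<lambda>k. wave_kernel n t y k - wave_kernel n t z k)) / (2 * pi)"
    by (simp add: norm_divide norm_mult)
  also have "\<dots> \<le> integral {0..R} (\<lambda>k. 2 * \<bar>y - z\<bar>) / (2 * pi)"
    using norm_wave_kernel_diff_le[OF assms(1), of t y _ t z]
    by (intro divide_right_mono Henstock_Kurzweil_Integration.integral_norm_bound_integral
        integrable_diff int integrable_const_ivl) auto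
  also have "\<dots> = R * \<bar>y - z\<bar> / pi"
    using assms by simp
  also have "\<dots> \<le> R * \<bar>y - z\<bar>"
    using pi_gt3 assms by (simp add: divide_le_eq mult_le_cancel_left1 not_less)
  finally show ?thesis .
qed

lemma continuous_truncated_front:
  assumes "n \<ge> 1" "R \<ge> 0"
  shows "continuous_on A (truncated_front n t R)"
proof -
  have "R-lipschitz_on A (truncated_front n t R)"
    using truncated_front_Lipschitz[OF assms] assms by (intro lipschitz_onI) (auto simp: dist_norm)
  then show ?thesis by (rule lipschitz_on_continuous_on)
qed

text \<open>Self-similarity: the substitution of \<open>s * k\<close> for \<open>k\<close> turns the
  phase \<open>k ^ n * s ^ n\<close> into that of time 1. The cutoff becomes \<open>R * s\<close>,
  which still tends to infinity with \<open>R\<close>, so a single profile governs all positive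
  times.\<close>

lemma truncated_front_scale:
  assumes "s > 0" "R \<ge> 0"
  shows "truncated_front n (s ^ n) R y = truncated_front n 1 (R * s) (y / s)"
proof -
  have image: "(\<lambda>x. x / s) ` {0..R * s} = {0..R}"
    using assms by (simp add: image_divide_atLeastAtMost)
  have eq: "wave_kernel n (s ^ n) y k = s *\<^sub>R wave_kernel n 1 (y / s) (s * k)" for k
    using assms by (cases "k = 0")
      (simp_all add: wave_kernel_def power_mult_distrib scaleR_conv_of_real field_simps flip: power_mult_distrib)
  have "integral {0..R} (wave_kernel n (s ^ n) y) = s *\<^sub>R integral {0..R} (\<lambda>k. wave_kernel n 1 (y / s) (s * k))"
    unfolding eq by simp
  also have "integral {0..R} (\<lambda>k. wave_kernel n 1 (y / s) (s * k)) =
      (1 / s) *\<^sub>R integral {0..R * s} (wave_kernel n 1 (y / s))"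
    using integral_stretch_real[of s 0 "R * s" "wave_kernel n 1 (y / s)"] assms image by simp
  finally show ?thesis
    using assms by (simp add: truncated_front_def)
qed

section \<open>Tail estimates and comparison with the sine integral\<close>

text \<open>Away from \<open>k = 0\<close> the two exponentials of the kernel can be integrated
  separately. Each is, up to complex conjugation, of the form \<open>cis (k ^ n + k * z)\<close>
  with \<open>z\<close> equal to \<open>y\<close> or \<open>- y\<close>. Estimates are therefore
  needed only for this convex phase.\<close>

lemma norm_integral_wave_kernel_le:
  assumes "0 < a" "n \<ge> 1"
    and le: "\<And>z. \<bar>z\<bar> = \<bar>y\<bar> \<Longrightarrow> cmod (integral {a..b} (\<lambda>k. (1 / k) *\<^sub>R cis (k ^ n + k * z))) \<le> B"
  shows "cmod (integral {a..b} (wave_kernel n 1 y)) \<le> 2 * B"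
proof -
  define J where "J z k = (1 / k) *\<^sub>R cis (k ^ n + k * z)" for z k
  have J: "J z integrable_on {a..b}" for z
    unfolding J_def using assms(1) by (intro integrable_continuous_real continuous_intros) auto
  have cnj_J: "(\<lambda>k. cnj (J z k)) integrable_on {a..b}" for z
    unfolding J_def using assms(1) by (intro integrable_continuous_real continuous_intros) auto
  have le': "cmod (integral {a..b} (J z)) \<le> B" "cmod (integral {a..b} (\<lambda>k. cnj (J z k))) \<le> B"
    if "\<bar>z\<bar> = \<bar>y\<bar>" for z
    using le[OF that] unfolding J_def[abs_def] integral_cnj[symmetric] by (auto simp: integral_cnj[symmetric])
  have "\<exists>H. (\<forall>k\<in>{a..b}. wave_kernel n 1 y k = - \<i> * (cnj (J (- y) k) - H k)) \<and>
      H integrable_on {a..b} \<and> cmod (integral {a..b} H) \<le> B"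
  \<comment> \<open>The first exponential is always the conjugate of the one in
    \<open>J (- y)\<close>. In the second one, \<open>(- k) ^ n\<close> equals \<open>k ^ n\<close>
    for even \<open>n\<close>, which gives the conjugate of \<open>J y\<close>; it equals
    \<open>- k ^ n\<close> for odd \<open>n\<close>, which gives \<open>J (- y)\<close>
    itself.\<close>
  proof (cases "even n")
    case True
    have "wave_kernel n 1 y k = - \<i> * (cnj (J (- y) k) - cnj (J y k))" if "k \<in> {a..b}" for k
      using True that assms
      by (simp add: wave_kernel_def J_def scaleR_conv_of_real divide_simps cis_cnj algebra_simps)
    then show ?thesis
      using cnj_J[of y] le'(2)[of y] by (intro exI[of _ "\<lambda>k. cnj (J y k)"]) auto
  next
    case False
    have "wave_kernel n 1 y k = - \<i> * (cnj (J (- y) k) - J (- y) k)" if "k \<in> {a..b}" for k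
      using False that assms
      by (simp add: wave_kernel_def J_def scaleR_conv_of_real divide_simps cis_cnj algebra_simps)
    then show ?thesis
      using J[of "- y"] le'(1)[of "- y"] by (intro exI[of _ "J (- y)"]) auto
  qed
  then obtain H where H: "\<And>k. k \<in> {a..b} \<Longrightarrow> wave_kernel n 1 y k = - \<i> * (cnj (J (- y) k) - H k)"
      "H integrable_on {a..b}" "cmod (integral {a..b} H) \<le> B" by blast
  have "integral {a..b} (wave_kernel n 1 y) = integral {a..b} (\<lambda>k. - \<i> * (cnj (J (- y) k) - H k))"
    using H(1) by (intro Henstock_Kurzweil_Integration.integral_cong) auto
  also have "\<dots> = - \<i> * (integral {a..b} (\<lambda>k. cnj (J (- y) k)) - integral {a..b} H)"
    by (simp only: integral_mult_right Henstock_Kurzweil_Integration.integral_diff[OF cnj_J H(2)])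
  also have "cmod \<dots> \<le> B + B"
    unfolding norm_mult using norm_triangle_ineq4[of "integral {a..b} (\<lambda>k. cnj (J (- y) k))" "integral {a..b} H"]
      le'(2)[of "- y"] H(3) by simp
  finally show ?thesis by simp
qed

text \<open>Van der Corput's bound for the phase \<open>k ^ n + k * z\<close> with amplitude
  \<open>1 / k\<close>. The linear term does not affect the second derivative, which makes the
  estimate uniform in \<open>y\<close>; the amplitude contributes the factor
  \<open>1 / r\<close>.\<close>

lemma norm_truncated_front_tail_le:
  assumes n: "n \<ge> 2" and R: "1 \<le> r" "r \<le> R"
  shows "cmod (truncated_front n 1 R y - truncated_front n 1 r y) \<le> 5 / (real n * r)"
proof -
  define N where "N = real n"
  have N: "N \<ge> 2" using n by (simp add: N_def)
  have "cmod (integral {r..R} (\<lambda>k. (1 / k) *\<^sub>R cis (k ^ n + k * z))) \<le> 15 / (N * r)" for z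
  proof -
    \<comment> \<open>For \<open>k \<ge> 1\<close> the second derivative
      \<open>n (n - 1) k ^ (n - 2)\<close> is at least \<open>l = N\<^sup>2 / 2\<close>. The choice
      \<open>\<mu> = N / 2\<close> has the order of the square root of \<open>l\<close>, so that
      \<open>1 / \<mu>\<close> and \<open>\<mu> / l\<close> are both of order
      \<open>1 / N\<close>.\<close>
    have "cmod (integral {r..R} (\<lambda>k. (1 / k) *\<^sub>R cis (k ^ n + k * z)))
        \<le> (1 / r) * (3 / (2 * (N / 2)) + pi / (N / 2) + pi * (N / 2) / (N\<^sup>2 / 2))"
    proof (rule van_der_Corput_second_derivative[where p = "\<lambda>k. N * k ^ (n - 1) + z"
          and p' = "\<lambda>k. N * (real (n - 1) * k ^ (n - 1 - 1))" and \<psi>' = "\<lambda>k. - 1 / k\<^sup>2"])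
      fix k assume k: "k \<in> {r..R}"
      show "((\<lambda>k. k ^ n + k * z) has_real_derivative N * k ^ (n - 1) + z) (at k within {r..R})"
        unfolding N_def by (rule derivative_eq_intros refl | simp)+
      show "((\<lambda>k. N * k ^ (n - 1) + z) has_real_derivative N * (real (n - 1) * k ^ (n - 1 - 1)))
          (at k within {r..R})"
        by (rule derivative_eq_intros refl | simp)+
      show "((/) 1 has_real_derivative - 1 / k\<^sup>2) (at k within {r..R})"
        using k R by (auto intro!: derivative_eq_intros simp: power2_eq_square)
      have "1 \<le> k ^ (n - 1 - 1)" using k R by (intro one_le_power) auto
      then have "real (n - 1) * 1 \<le> real (n - 1) * k ^ (n - 1 - 1)"
        by (rule mult_left_mono) simp
      moreover have "N / 2 \<le> real (n - 1)"
        using n by (simp add: N_def of_nat_diff)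
      ultimately have "N / 2 \<le> real (n - 1) * k ^ (n - 1 - 1)"
        unfolding mult.right_neutral by (rule order_trans[rotated])
      then have "N * (N / 2) \<le> N * (real (n - 1) * k ^ (n - 1 - 1))"
        by (rule mult_left_mono) (use N in simp)
      then show "N\<^sup>2 / 2 \<le> N * (real (n - 1) * k ^ (n - 1 - 1))"
        by (simp add: power2_eq_square)
      show "0 \<le> 1 / k \<and> 1 / k \<le> 1 / r" using k R by (auto intro: divide_left_mono)
    qed (use R N in auto)
    also have "\<dots> = (3 + 3 * pi) / (N * r)"
      using N R by (simp add: field_simps power2_eq_square)
    also have "\<dots> \<le> 15 / (N * r)"
      using N R pi_less_4 by (intro divide_right_mono) auto
    finally show ?thesis .
  qed
  then have "cmod (integral {r..R} (wave_kernel n 1 y)) \<le> 2 * (15 / (N * r))"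
    using R n by (intro norm_integral_wave_kernel_le) auto
  then have "cmod (integral {r..R} (wave_kernel n 1 y)) / (2 * pi) \<le> 2 * (15 / (N * r)) / (2 * pi)"
    by (rule divide_right_mono) simp
  also have "\<dots> = 15 / (N * r) / pi" by simp
  also have "\<dots> \<le> 15 / (N * r) / 3"
    using pi_gt3 N R by (intro divide_left_mono) auto
  finally show ?thesis
    using truncated_front_diff[of n r R 1 y] n R by (simp add: norm_divide norm_mult N_def mult.commute)
qed

text \<open>Integration by parts against the linear part \<open>k * z\<close> of the phase alone,
  with weight \<open>1 / (z * k)\<close>. The contribution of \<open>k ^ n\<close> is left in the
  error, which is harmless on a fixed interval: \<open>K\<close> depends on \<open>n\<close>,
  \<open>r\<close> and \<open>R\<close>, but not on \<open>y\<close>.\<close>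

lemma truncated_front_Riemann_Lebesgue:
  assumes n: "n \<ge> 1" and R: "0 < r" "r \<le> R"
  shows "\<exists>K. \<forall>y. y \<noteq> 0 \<longrightarrow>
    cmod (truncated_front n 1 R y - truncated_front n 1 r y) \<le> K / \<bar>y\<bar>"
proof -
  \<comment> \<open>The two summands bound, up to the factor \<open>1 / \<bar>z\<bar>\<close>, the
    uncancelled contribution of \<open>k ^ n\<close> and the derivative of the weight.
    \<open>K\<close> adds the boundary values of the weight.\<close>
  define C where "C = real n * R ^ (n - 1) / r + 1 / r\<^sup>2"
  define K where "K = 1 / r + 1 / R + C * (R - r)"
  have *: "cmod (integral {r..R} (\<lambda>k. (1 / k) *\<^sub>R cis (k ^ n + k * z))) \<le> K / \<bar>y\<bar>"
    if z: "z \<noteq> 0" and zy: "\<bar>z\<bar> = \<bar>y\<bar>" for y z :: real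
  proof -
    have "cmod (integral {r..R} (\<lambda>k. (1 / k) *\<^sub>R cis (k ^ n + k * z)))
        \<le> \<bar>1 / (z * r)\<bar> + \<bar>1 / (z * R)\<bar> + (C / \<bar>z\<bar> * R - C / \<bar>z\<bar> * r)"
    proof (rule oscillatory_integral_bound[where p = "\<lambda>k. real n * k ^ (n - 1) + z"
          and w' = "\<lambda>k. - 1 / (z * k\<^sup>2)" and G' = "\<lambda>_. C / \<bar>z\<bar>"])
      fix k assume k: "k \<in> {r..R}"
      then have k0: "k > 0" using R by auto
      show "((\<lambda>k. k ^ n + k * z) has_real_derivative real n * k ^ (n - 1) + z) (at k within {r..R})"
        by (rule derivative_eq_intros refl | simp)+
      show "((\<lambda>k. 1 / (z * k)) has_real_derivative - 1 / (z * k\<^sup>2)) (at k within {r..R})"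
        using k0 z by (auto intro!: derivative_eq_intros simp: power2_eq_square)
      show "((\<lambda>k. C / \<bar>z\<bar> * k) has_real_derivative C / \<bar>z\<bar>) (at k within {r..R})"
        by (rule derivative_eq_intros refl | simp)+
      have "1 / k - 1 / (z * k) * (real n * k ^ (n - 1) + z) = - (real n * k ^ (n - 1) / k) / z"
        using k0 z by (simp add: field_simps)
      then have "\<bar>1 / k - 1 / (z * k) * (real n * k ^ (n - 1) + z)\<bar> = (real n * k ^ (n - 1) / k) / \<bar>z\<bar>"
        using k0 by (simp add: abs_mult)
      also have "\<dots> \<le> (real n * R ^ (n - 1) / r) / \<bar>z\<bar>"
        using k R by (intro divide_right_mono frac_le mult_left_mono power_mono) auto
      moreover have "\<bar>- 1 / (z * k\<^sup>2)\<bar> = (1 / k\<^sup>2) / \<bar>z\<bar>"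
        by (simp add: abs_mult)
      moreover have "(1 / k\<^sup>2) / \<bar>z\<bar> \<le> (1 / r\<^sup>2) / \<bar>z\<bar>"
        using k R by (intro divide_right_mono divide_left_mono power_mono) auto
      ultimately show "\<bar>1 / k - 1 / (z * k) * (real n * k ^ (n - 1) + z)\<bar> + \<bar>- 1 / (z * k\<^sup>2)\<bar> \<le> C / \<bar>z\<bar>"
        unfolding C_def add_divide_distrib by linarith
    qed (use R in \<open>auto intro!: continuous_intros\<close>)
    also have "\<dots> = K / \<bar>z\<bar>"
      using R by (simp add: K_def abs_mult add_divide_distrib diff_divide_distrib right_diff_distrib mult.commute)
    finally show ?thesis unfolding zy .
  qed
  have "cmod (truncated_front n 1 R y - truncated_front n 1 r y) \<le> (K / pi) / \<bar>y\<bar>" if "y \<noteq> 0" for y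
  proof -
    have "cmod (integral {r..R} (wave_kernel n 1 y)) \<le> 2 * (K / \<bar>y\<bar>)"
      using R n by (intro norm_integral_wave_kernel_le) (use * that in \<open>auto dest: sym\<close>)
    then have "cmod (integral {r..R} (wave_kernel n 1 y)) / (2 * pi) \<le> 2 * (K / \<bar>y\<bar>) / (2 * pi)"
      by (rule divide_right_mono) simp
    also have "\<dots> = (K / pi) / \<bar>y\<bar>" by simp
    finally show ?thesis
      using truncated_front_diff[of n r R 1 y] n R by (simp add: norm_divide norm_mult)
  qed
  then show ?thesis by blast
qed

lemma has_integral_wave_kernel_time_0:
  assumes "r \<ge> 0"
  shows "(wave_kernel n 0 y has_integral of_real (2 * Si (r * y))) {0..r}"
proof -
  have "((\<lambda>k. 2 * (y * sinc (k * y))) has_integral 2 * Si (r * y) - 2 * Si (0 * y)) {0..r}"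
  proof (rule fundamental_theorem_of_calculus[OF assms])
    fix k
    have "((\<lambda>k. 2 * Si (k * y)) has_real_derivative 2 * (y * sinc (k * y))) (at k within {0..r})"
      by (rule derivative_eq_intros DERIV_chain2[OF DERIV_Si] refl | simp)+
    then show "((\<lambda>k. 2 * Si (k * y)) has_vector_derivative 2 * (y * sinc (k * y))) (at k within {0..r})"
      by (simp add: has_real_derivative_iff_has_vector_derivative)
  qed
  then have "((\<lambda>k. complex_of_real (2 * (y * sinc (k * y)))) has_integral of_real (2 * Si (r * y))) {0..r}"
    by (intro has_integral_of_real) simp
  then show ?thesis
    \<comment> \<open>At \<open>k = 0\<close> the kernel is 0 while the sinc expression is
      \<open>2 * y\<close>; the integral ignores this point.\<close>
    by (rule has_integral_spike_finite[of "{0}", rotated 2])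
       (auto simp: wave_kernel_def cis.ctr complex_eq_iff Re_divide Im_divide power2_eq_square)
qed

text \<open>Dropping the factor \<open>cis (- (k ^ n))\<close> changes the kernel by at most
  \<open>2 * k ^ (n - 1)\<close>, and at time 0 the integral is explicit. The bound is small for
  \<open>r = 1\<close> and large \<open>n\<close>, and also for fixed \<open>n\<close> and small
  \<open>r\<close>; both regimes are used.\<close>

lemma norm_truncated_front_minus_Si_le:
  assumes n: "n \<ge> 1" and r: "r \<ge> 0"
  shows "cmod (truncated_front n 1 r y - of_real (Si (r * y) / pi)) \<le> r ^ n / real n"
proof -
  note int = wave_kernel_integrable[OF n, of _ y 0 r]
  have pow: "((\<lambda>k. 2 * k ^ (n - 1)) has_integral 2 * r ^ n / real n - 2 * 0 ^ n / real n) {0..r}"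
  proof (rule fundamental_theorem_of_calculus[OF r])
    fix k
    have "((\<lambda>k. 2 * k ^ n / real n) has_real_derivative 2 * k ^ (n - 1)) (at k within {0..r})"
      using n by (auto intro!: derivative_eq_intros)
    then show "((\<lambda>k. 2 * k ^ n / real n) has_vector_derivative 2 * k ^ (n - 1)) (at k within {0..r})"
      by (simp add: has_real_derivative_iff_has_vector_derivative)
  qed
  have le: "cmod (wave_kernel n 1 y k - wave_kernel n 0 y k) \<le> 2 * k ^ (n - 1)"
    if "k \<in> {0..r}" for k
    using norm_wave_kernel_diff_le[OF n, of 1 y k 0 y] that by simp
  have "truncated_front n 1 r y - of_real (Si (r * y) / pi) =
      integral {0..r} (\<lambda>k. wave_kernel n 1 y k - wave_kernel n 0 y k) / (2 * of_real pi)"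
    using integral_unique[OF has_integral_wave_kernel_time_0[OF r, of n y]]
    by (simp add: truncated_front_def Henstock_Kurzweil_Integration.integral_diff[OF int int] diff_divide_distrib)
  also have "cmod \<dots> = cmod (integral {0..r} (\<lambda>k. wave_kernel n 1 y k - wave_kernel n 0 y k)) / (2 * pi)"
    by (simp add: norm_divide norm_mult)
  also have "\<dots> \<le> integral {0..r} (\<lambda>k. 2 * k ^ (n - 1)) / (2 * pi)"
    by (intro divide_right_mono Henstock_Kurzweil_Integration.integral_norm_bound_integral
        integrable_diff int has_integral_integrable[OF pow] le) (use pi_gt_zero in auto)
  also have "\<dots> = r ^ n / real n / pi"
    unfolding integral_unique[OF pow] using n by (simp add: zero_power)
  also have "\<dots> \<le> r ^ n / real n"
    using pi_gt3 r divide_left_mono[of 1 pi "r ^ n / real n"] by simp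
  finally show ?thesis .
qed

section \<open>The profile and the box solution\<close>

text \<open>The tail estimate makes the integer cutoffs a Cauchy sequence, so the \<open>lim\<close>
  in the definition of \<open>front\<close> is a genuine limit. The same estimate then passes to the
  limit, uniformly in \<open>y\<close>.\<close>

lemma norm_front_minus_truncated_front_le:
  assumes n: "n \<ge> 2" and R: "1 \<le> R"
  shows "cmod (front n y - truncated_front n 1 R y) \<le> 5 / (real n * R)"
proof -
  let ?X = "\<lambda>m. truncated_front n 1 (real m) y"
  have "Cauchy ?X"
  proof (rule metric_CauchyI)
    fix e :: real assume e: "e > 0"
    obtain M :: nat where M: "real M > max 1 (5 / e)" using reals_Archimedean2 by blast
    have M1: "real M \<ge> 1" "M > 0" and M2: "5 < e * real M"
      using M e by (auto simp: field_simps intro: gr0I)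
    have "5 / (real n * real M) < e / 2"
    proof -
      have "5 < (e * real M) * 1" using M2 by simp
      also have "\<dots> \<le> (e * real M) * (real n / 2)" using n e by (intro mult_left_mono) auto
      finally show ?thesis using n M1 by (simp add: field_simps)
    qed
    then have "dist (?X m) (?X M) < e / 2" if "m \<ge> M" for m
      using norm_truncated_front_tail_le[OF n M1(1), of "real m" y] that by (simp add: dist_norm)
    then show "\<exists>M. \<forall>m\<ge>M. \<forall>l\<ge>M. dist (?X m) (?X l) < e"
      using dist_triangle_half_l by blast
  qed
  then have lim: "?X \<longlonglongrightarrow> front n y"
    unfolding front_def by (simp add: Cauchy_convergent convergent_LIMSEQ_iff[symmetric])
  show ?thesis
  proof (rule tendsto_upperbound)
    show "(\<lambda>m. cmod (?X m - truncated_front n 1 R y)) \<longlonglongrightarrow> cmod (front n y - truncated_front n 1 R y)"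
      by (intro tendsto_intros lim)
    show "\<forall>\<^sub>F m in sequentially. cmod (?X m - truncated_front n 1 R y) \<le> 5 / (real n * R)"
      using eventually_ge_at_top[of "nat \<lceil>R\<rceil>"]
      by eventually_elim (intro norm_truncated_front_tail_le n R, linarith)
  qed simp
qed

lemma truncated_front_tendsto_front:
  assumes n: "n \<ge> 2"
  shows "((\<lambda>R. truncated_front n 1 R y) \<longlongrightarrow> front n y) at_top"
proof -
  have "((\<lambda>R. truncated_front n 1 R y - front n y) \<longlongrightarrow> 0) at_top"
  proof (rule Lim_null_comparison)
    show "\<forall>\<^sub>F R in at_top. norm (truncated_front n 1 R y - front n y) \<le> 5 / (real n * R)"
      using eventually_ge_at_top[of 1]
      by eventually_elim (metis n norm_front_minus_truncated_front_le norm_minus_commute)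
    show "((\<lambda>R. 5 / (real n * R)) \<longlongrightarrow> 0) at_top"
      using n by real_asymp
  qed
  then show ?thesis by (rule Lim_null[THEN iffD2])
qed

lemma continuous_front:
  assumes n: "n \<ge> 2"
  shows "continuous_on UNIV (front n)"
proof (rule uniform_limit_theorem[where F = at_top])
  show "\<forall>\<^sub>F R in at_top. continuous_on UNIV (truncated_front n 1 R)"
    using eventually_ge_at_top[of 0]
    by eventually_elim (use n in \<open>intro continuous_truncated_front, auto\<close>)
  show "uniform_limit UNIV (truncated_front n 1) (front n) at_top"
  proof (rule uniform_limitI)
    fix e :: real assume "e > 0"
    then have "\<forall>\<^sub>F R in at_top. 5 / (real n * R) < e"
      using n by real_asymp
    then show "\<forall>\<^sub>F R in at_top. \<forall>y\<in>UNIV. dist (truncated_front n 1 R y) (front n y) < e"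
      using eventually_ge_at_top[of 1]
    proof eventually_elim
      case (elim R)
      then show ?case
        using norm_front_minus_truncated_front_le[OF n, of R]
        by (metis dist_norm dist_commute le_less_trans)
    qed
  qed
qed simp

text \<open>Splitting at \<open>k = 1\<close>: the tail costs \<open>5 / n\<close> and the removal
  of the dispersive phase below 1 costs \<open>1 / n\<close>. This uniform estimate drives the outer
  limit over \<open>n\<close>.\<close>

lemma norm_front_minus_Si_le:
  assumes n: "n \<ge> 2"
  shows "cmod (front n y - of_real (Si y / pi)) \<le> 6 / real n"
proof -
  have "cmod (front n y - of_real (Si y / pi)) \<le>
      cmod (front n y - truncated_front n 1 1 y) + cmod (truncated_front n 1 1 y - of_real (Si y / pi))"
    by norm
  also have "\<dots> \<le> 5 / real n + 1 / real n"
    using norm_front_minus_truncated_front_le[OF n, of 1 y] norm_truncated_front_minus_Si_le[of n 1 y] n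
    by simp
  finally show ?thesis by (simp add: add_divide_distrib[symmetric])
qed

text \<open>Here \<open>n\<close> is fixed and \<open>\<bar>y\<bar>\<close> is large. Frequencies
  below a small \<open>r\<close> are compared with the sine integral, those between \<open>r\<close>
  and a large \<open>R\<close> decay like \<open>1 / \<bar>y\<bar>\<close>, and those above
  \<open>R\<close> contribute little by the tail estimate.\<close>

lemma front_close_to_Si:
  assumes n: "n \<ge> 2" and e: "e > 0"
  shows "\<exists>r>0. \<exists>K. \<forall>y. y \<noteq> 0 \<longrightarrow> cmod (front n y - of_real (Si (r * y) / pi)) \<le> e + K / \<bar>y\<bar>"
proof -
  define r where "r = min 1 (e / 2)"
  have r: "0 < r" "r \<le> 1" "r \<le> e / 2" using e by (auto simp: r_def)
  obtain R where R: "1 \<le> R" "5 / (real n * R) < e / 2"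
  proof -
    have "\<forall>\<^sub>F R in at_top. 1 \<le> R \<and> 5 / (real n * R) < e / 2"
      by (intro eventually_conj eventually_ge_at_top) (use n e in real_asymp)
    then show thesis using that by (auto simp: eventually_at_top_linorder)
  qed
  obtain K where K: "\<And>y. y \<noteq> 0 \<Longrightarrow> cmod (truncated_front n 1 R y - truncated_front n 1 r y) \<le> K / \<bar>y\<bar>"
    using truncated_front_Riemann_Lebesgue[of n r R] n r R by auto
  have rn: "r ^ n / real n \<le> e / 2"
  proof -
    have "r ^ n \<le> r" using r n power_decreasing[of 1 n r] by simp
    then have "r ^ n / real n \<le> r / 1" using n r by (intro frac_le) auto
    then show ?thesis using r by linarith
  qed
  have "cmod (front n y - of_real (Si (r * y) / pi)) \<le> e + K / \<bar>y\<bar>" if "y \<noteq> 0" for y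
  proof -
    have "cmod (front n y - of_real (Si (r * y) / pi)) \<le> cmod (front n y - truncated_front n 1 R y) +
        cmod (truncated_front n 1 R y - truncated_front n 1 r y) +
        cmod (truncated_front n 1 r y - of_real (Si (r * y) / pi))"
      by norm
    moreover have "cmod (truncated_front n 1 r y - of_real (Si (r * y) / pi)) \<le> r ^ n / real n"
      using n r by (intro norm_truncated_front_minus_Si_le) auto
    ultimately show ?thesis
      using K[OF that] norm_front_minus_truncated_front_le[OF n R(1), of y] R(2) rn by linarith
  qed
  then show ?thesis using r by blast
qed

text \<open>The limit of \<open>Si (r * y)\<close> is the same for every \<open>r > 0\<close>, so
  the dependence of \<open>r\<close> on the accuracy \<open>e\<close> does no harm. The filter
  \<open>F\<close> stands for \<open>at_top\<close> or \<open>at_bot\<close>.\<close>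

lemma front_tendsto:
  assumes n: "n \<ge> 2"
    and F: "filterlim abs at_top F"
    and Si: "\<And>r. r > 0 \<Longrightarrow> ((\<lambda>y. Si (r * y)) \<longlongrightarrow> l) F"
  shows "(front n \<longlongrightarrow> of_real (l / pi)) F"
proof (rule tendstoI)
  fix e :: real assume e: "e > 0"
  obtain r K where r: "r > 0"
    and K: "\<And>y. y \<noteq> 0 \<Longrightarrow> cmod (front n y - of_real (Si (r * y) / pi)) \<le> e / 2 + K / \<bar>y\<bar>"
    using front_close_to_Si[OF n, of "e / 2"] e by auto
  have "((\<lambda>y. K / \<bar>y\<bar>) \<longlongrightarrow> 0) F"
    by (rule real_tendsto_divide_at_top[OF tendsto_const F])
  then have "((\<lambda>y. e / 2 + K / \<bar>y\<bar> + \<bar>Si (r * y) / pi - l / pi\<bar>) \<longlongrightarrow> e / 2 + 0 + \<bar>l / pi - l / pi\<bar>) F"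
    using r by (intro tendsto_intros Si) auto
  then have "\<forall>\<^sub>F y in F. e / 2 + K / \<bar>y\<bar> + \<bar>Si (r * y) / pi - l / pi\<bar> < e"
    by (rule order_tendstoD(2)) (use e in simp)
  moreover have "\<forall>\<^sub>F y in F. \<bar>y\<bar> > 0"
    using F by (simp only: filterlim_at_top_dense)
  ultimately show "\<forall>\<^sub>F y in F. dist (front n y) (of_real (l / pi)) < e"
  proof eventually_elim
    case (elim y)
    have "dist (front n y) (of_real (l / pi)) \<le> cmod (front n y - of_real (Si (r * y) / pi)) +
        cmod (of_real (Si (r * y) / pi) - of_real (l / pi))"
      unfolding dist_norm by norm
    also have "cmod (of_real (Si (r * y) / pi) - of_real (l / pi)) = \<bar>Si (r * y) / pi - l / pi\<bar>"
      by (metis norm_of_real of_real_diff real_norm_def)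
    finally show ?case using K[of y] elim by linarith
  qed
qed

lemma front_at_top:
  assumes "n \<ge> 2"
  shows "(front n \<longlongrightarrow> 1 / 2) at_top"
proof -
  have "(front n \<longlongrightarrow> of_real ((pi / 2) / pi)) at_top"
  proof (rule front_tendsto[OF assms])
    show "filterlim (abs :: real \<Rightarrow> real) at_top at_top" by (rule filterlim_abs_real)
    show "((\<lambda>y. Si (r * y)) \<longlongrightarrow> pi / 2) at_top" if "r > 0" for r
      using that by (intro filterlim_compose[OF Si_at_top]) real_asymp
  qed
  then show ?thesis by simp
qed

lemma front_at_bot:
  assumes "n \<ge> 2"
  shows "(front n \<longlongrightarrow> - (1 / 2)) at_bot"
proof -
  have "(front n \<longlongrightarrow> of_real (- (pi / 2) / pi)) at_bot"
  proof (rule front_tendsto[OF assms])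
    show "filterlim (abs :: real \<Rightarrow> real) at_top at_bot" by real_asymp
    show "((\<lambda>y. Si (r * y)) \<longlongrightarrow> - (pi / 2)) at_bot" if "r > 0" for r
      using that by (intro filterlim_compose[OF Si_at_bot]) real_asymp
  qed
  then show ?thesis by simp
qed

section \<open>The solution with box datum as a difference of two fronts\<close>

lemma fourier_transform_box_datum: "fourier_transform box_datum k = of_real (2 * sinc k)"
proof -
  have "fourier_transform box_datum k = (LINT x:{-1..1}|lborel. cis (- (k * x)))"
    unfolding fourier_transform_def set_lebesgue_integral_def
    by (intro Bochner_Integration.integral_cong refl) (auto simp: box_datum_def indicator_def)
  also have "\<dots> = integral {-1..1} (\<lambda>x. cis (- (k * x)))"
    by (intro set_borel_integral_eq_integral borel_integrable_atLeastAtMost' continuous_intros)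
  also have "((\<lambda>x. cis (- (k * x))) has_integral of_real (2 * sinc k)) {-1..1}"
  proof (cases "k = 0")
    case True
    then show ?thesis using has_integral_const_real[of "1::complex" "-1" 1] by (simp add: scaleR_conv_of_real)
  next
    case False
    have "((\<lambda>x. cis (- (k * x))) has_integral \<i> * cis (- (k * 1)) / k - \<i> * cis (- (k * -1)) / k) {-1..1}"
    proof (rule fundamental_theorem_of_calculus)
      fix x
      have "((\<lambda>x. cis (- (k * x))) has_vector_derivative (- k) *\<^sub>R (\<i> * cis (- (k * x)))) (at x within {-1..1})"
        by (rule has_vector_derivative_cis) (auto intro!: derivative_eq_intros)
      from has_vector_derivative_mult_right[OF this, of "\<i> / k"]
      show "((\<lambda>x. \<i> * cis (- (k * x)) / k) has_vector_derivative cis (- (k * x))) (at x within {-1..1})"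
        using False by (simp add: scaleR_conv_of_real)
    qed simp
    also have "\<i> * cis (- (k * 1)) / k - \<i> * cis (- (k * -1)) / k = of_real (2 * sinc k)"
      using False by (simp add: complex_eq_iff cis.ctr)
    finally show ?thesis .
  qed
  then have "integral {-1..1} (\<lambda>x. cis (- (k * x))) = of_real (2 * sinc k)"
    by (rule integral_unique)
  finally show ?thesis .
qed

text \<open>The transform of the box is \<open>(cis k - cis (- k)) / (\<i> * k)\<close>. Its two
  exponentials shift \<open>x\<close> to \<open>x + 1\<close> and \<open>x - 1\<close>, one for each
  jump, and folding \<open>- k\<close> onto \<open>k\<close> produces the kernels.\<close>

lemma truncated_solution_box_datum:
  assumes n: "n \<ge> 1" and R: "R \<ge> 0"
  shows "truncated_solution n box_datum R x t = truncated_front n t R (x + 1) - truncated_front n t R (x - 1)"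
proof -
  define g where "g k = cis (k * x - k ^ n * t) * of_real (2 * sinc k)" for k
  have cont: "continuous_on A g" for A
    unfolding g_def by (intro continuous_intros)
  have g: "g integrable_on {a..b}" for a b
    by (intro integrable_continuous_real cont)
  have g': "(\<lambda>k. g (- k)) integrable_on {a..b}" for a b
    by (intro integrable_continuous_real continuous_on_compose2[OF cont[of UNIV]] continuous_intros) auto
  note int = wave_kernel_integrable[OF n, of t _ 0 R]
  have sym: "g k + g (- k) = wave_kernel n t (x + 1) k - wave_kernel n t (x - 1) k" if "k \<noteq> 0" for k
  proof -
    have sinc: "complex_of_real (2 * sinc k) = (cis k - cis (- k)) / (\<i> * of_real k)"
      using that by (simp add: complex_eq_iff cis.ctr Re_divide Im_divide power2_eq_square)
    have "g (- k) = cis (- (k * x) - (- k) ^ n * t) * of_real (2 * sinc k)"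
      by (simp add: g_def)
    then have "g k + g (- k) =
        (cis (k * x - k ^ n * t) * (cis k - cis (- k)) + cis (- (k * x) - (- k) ^ n * t) * (cis k - cis (- k)))
          / (\<i> * of_real k)"
      unfolding g_def sinc by (simp add: add_divide_distrib)
    also have "\<dots> = wave_kernel n t (x + 1) k - wave_kernel n t (x - 1) k"
      unfolding wave_kernel_def diff_divide_distrib[symmetric]
      by (simp add: right_diff_distrib cis_mult ring_distribs) (simp add: algebra_simps)
    finally show ?thesis .
  qed
  have "(LINT k:{-R..R}|lborel. g k) = integral {-R..R} g"
    by (intro set_borel_integral_eq_integral borel_integrable_atLeastAtMost' cont)
  also have "\<dots> = integral {-R..0} g + integral {0..R} g"
    using Henstock_Kurzweil_Integration.integral_combine[OF _ R g, of "- R"] R by simp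
  also have "integral {-R..0} g = integral {0..R} (\<lambda>k. g (- k))"
    using Henstock_Kurzweil_Integration.integral_reflect_real[of R 0 "\<lambda>k. g (- k)"] by simp
  also have "integral {0..R} (\<lambda>k. g (- k)) + integral {0..R} g = integral {0..R} (\<lambda>k. g k + g (- k))"
    by (simp add: Henstock_Kurzweil_Integration.integral_add[OF g g'])
  also have "\<dots> = integral {0..R} (\<lambda>k. wave_kernel n t (x + 1) k - wave_kernel n t (x - 1) k)"
    by (rule integral_spike[of "{0}"]) (auto simp: sym)
  also have "\<dots> = integral {0..R} (wave_kernel n t (x + 1)) - integral {0..R} (wave_kernel n t (x - 1))"
    by (rule Henstock_Kurzweil_Integration.integral_diff[OF int int])
  finally show ?thesis
    unfolding truncated_solution_def truncated_front_def fourier_transform_box_datum g_def[symmetric]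
    by (simp add: diff_divide_distrib)
qed

text \<open>The truncated solutions converge pointwise to the difference of fronts and in mean
  square to \<open>q\<close>. Fatou's lemma shows that the two limits agree almost everywhere, and
  continuity makes them agree everywhere.\<close>

lemma L2_solution_eq:
  assumes n: "n \<ge> 2" and t: "t > 0" and sol: "L2_solution n box_datum q"
  shows "q x t = front n ((x + 1) / root n t) - front n ((x - 1) / root n t)"
proof -
  define s where "s = root n t"
  have s: "s > 0" "s ^ n = t" using n t by (auto simp: s_def)
  define Q where "Q x = front n ((x + 1) / s) - front n ((x - 1) / s)" for x
  define T where "T m x = truncated_solution n box_datum (real m) x t" for m x
  have T: "T m x = truncated_front n 1 (real m * s) ((x + 1) / s) - truncated_front n 1 (real m * s) ((x - 1) / s)"
    for m x
    using n s truncated_front_scale[OF s(1), of "real m" n] by (simp add: T_def truncated_solution_box_datum)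
  have T_lim: "(\<lambda>m. T m x) \<longlonglongrightarrow> Q x" for x
  proof -
    have "filterlim (\<lambda>m. real m * s) at_top sequentially"
      using s by real_asymp
    then show ?thesis
      unfolding T Q_def by (intro tendsto_diff filterlim_compose[OF truncated_front_tendsto_front[OF n]])
  qed
  have cont_q: "continuous_on UNIV (\<lambda>x. q x t)"
    using sol t by (auto simp: L2_solution_def)
  have cont_Q: "continuous_on UNIV Q"
    unfolding Q_def using s
    by (intro continuous_intros continuous_on_compose2[OF continuous_front[OF n]]) auto
  have cont_T: "continuous_on UNIV (T m)" for m
    unfolding T using s n
    by (intro continuous_intros continuous_on_compose2[OF continuous_truncated_front[where A = UNIV]]) auto
  have "(\<integral>\<^sup>+x. ennreal ((cmod (q x t - Q x))\<^sup>2) \<partial>lborel) =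
      (\<integral>\<^sup>+x. liminf (\<lambda>m. ennreal ((cmod (q x t - T m x))\<^sup>2)) \<partial>lborel)"
    by (intro nn_integral_cong lim_imp_Liminf[symmetric] tendsto_intros T_lim) auto
  also have "\<dots> \<le> liminf (\<lambda>m. \<integral>\<^sup>+x. ennreal ((cmod (q x t - T m x))\<^sup>2) \<partial>lborel)"
  proof (rule nn_integral_liminf)
    fix m
    have "(\<lambda>x. (cmod (q x t - T m x))\<^sup>2) \<in> borel_measurable borel"
      by (intro borel_measurable_continuous_onI continuous_intros cont_q cont_T)
    then show "(\<lambda>x. ennreal ((cmod (q x t - T m x))\<^sup>2)) \<in> borel_measurable lborel"
      by simp
  qed
  also have "\<dots> = 0"
  proof (rule lim_imp_Liminf)
    have "((\<lambda>R. \<integral>\<^sup>+x. ennreal ((cmod (q x t - truncated_solution n box_datum R x t))\<^sup>2) \<partial>lborel) \<longlongrightarrow> 0) at_top"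
      using sol t by (auto simp: L2_solution_def)
    from filterlim_compose[OF this filterlim_real_sequentially]
    show "(\<lambda>m. \<integral>\<^sup>+x. ennreal ((cmod (q x t - T m x))\<^sup>2) \<partial>lborel) \<longlonglongrightarrow> 0"
      by (simp add: T_def)
  qed simp
  finally have "(\<integral>\<^sup>+x. ennreal ((cmod (q x t - Q x))\<^sup>2) \<partial>lborel) = 0" by simp
  moreover have "(\<lambda>x. ennreal ((cmod (q x t - Q x))\<^sup>2)) \<in> borel_measurable lborel"
  proof -
    have "(\<lambda>x. (cmod (q x t - Q x))\<^sup>2) \<in> borel_measurable borel"
      by (intro borel_measurable_continuous_onI continuous_intros cont_q cont_Q)
    then show ?thesis by simp
  qed
  ultimately have "AE x in lborel. ennreal ((cmod (q x t - Q x))\<^sup>2) = 0"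
    by (simp add: nn_integral_0_iff_AE)
  \<comment> \<open>A closed set of full Lebesgue measure is the whole line; its complement is open
    and null, hence empty.\<close>
  then have "AE x in lebesgue. x \<in> {x. q x t = Q x}"
    by (intro AE_completion) (auto elim!: eventually_mono)
  moreover have "closed {x. q x t = Q x}"
    by (intro closed_Collect_eq cont_q cont_Q)
  ultimately have "x \<in> {x. q x t = Q x}"
    by (intro mem_closed_if_AE_lebesgue)
  then show ?thesis by (simp add: Q_def s_def)
qed

section \<open>Extrema over the interval\<close>

text \<open>
  In the variables \<open>u = (x + \<sigma>) / s\<close> and \<open>v = (x - \<sigma>) / s\<close> at most one of \<open>f u\<close>, \<open>f v\<close> is away from
  its limit at infinity, and \<open>u\<close> ranges eventually over all reals.  Whether \<open>v\<close> does depends on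
  the second jump lying inside (\<open>\<delta> > 2\<close>), on the boundary of (\<open>\<delta> = 2\<close>), or outside (\<open>\<delta> < 2\<close>) the interval.
\<close>

lemma SUP_front_difference_tendsto:
  fixes f :: "real \<Rightarrow> real"
  assumes top: "(f \<longlongrightarrow> l) at_top" and bot: "(f \<longlongrightarrow> - l) at_bot"
    and bound: "\<And>y. \<bar>f y\<bar> \<le> B"
    and \<sigma>: "\<sigma> \<in> {1, -1}" and \<delta>: "\<delta> > 0"
  defines "S \<equiv> range (\<lambda>u. f u + \<sigma> * l) \<union> (\<lambda>v. \<sigma> * l - f v) ` {v. \<delta> > 2 \<or> \<delta> = 2 \<and> \<sigma> * v \<le> 0}"
  shows "((\<lambda>s. SUP x\<in>{x. \<bar>x + \<sigma>\<bar> \<le> \<delta>}. f ((x + \<sigma>) / s) - f ((x - \<sigma>) / s)) \<longlongrightarrow> Sup S) (at_right 0)"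
proof (rule tendstoI)
  let ?I = "{x. \<bar>x + \<sigma>\<bar> \<le> \<delta>}"
  let ?h = "\<lambda>s x. f ((x + \<sigma>) / s) - f ((x - \<sigma>) / s)"
  have \<sigma>2: "\<sigma> * \<sigma> = 1" "\<bar>\<sigma>\<bar> = 1" using \<sigma> by auto
  have S_ne: "S \<noteq> {}" by (simp add: S_def)
  have S_bdd: "bdd_above S"
  proof (rule bdd_aboveI)
    fix a assume "a \<in> S"
    then obtain u where "a = f u + \<sigma> * l \<or> a = \<sigma> * l - f u" by (auto simp: S_def)
    then show "a \<le> B + \<sigma> * l" using bound[of u] by (auto simp: abs_le_iff)
  qed
  have h_bdd: "bdd_above (?h s ` ?I)" for s
  proof (rule bdd_aboveI2)
    fix x show "?h s x \<le> 2 * B"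
      using bound[of "(x + \<sigma>) / s"] bound[of "(x - \<sigma>) / s"] by linarith
  qed
  fix e :: real assume "e > 0"
  define d where "d = e / 3"
  have d: "d > 0" using \<open>e > 0\<close> by (simp add: d_def)
  obtain M1 where M1: "\<And>y. y \<ge> M1 \<Longrightarrow> \<bar>f y - l\<bar> < d"
    using tendstoD[OF top d] by (auto simp: eventually_at_top_linorder dist_real_def)
  obtain M2 where M2: "\<And>y. y \<le> M2 \<Longrightarrow> \<bar>f y + l\<bar> < d"
    using tendstoD[OF bot d] by (auto simp: eventually_at_bot_linorder dist_real_def)
  \<comment> \<open>One threshold for both ends. Because the limits of \<open>f\<close> at the two
    ends are opposite, multiplying by \<sigma> treats both signs at once: \<open>f y\<close> is near
    \<open>\<sigma> * l\<close> when \<open>\<sigma> * y\<close> is large, and near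
    \<open>- \<sigma> * l\<close> when it is very negative.\<close>
  define M where "M = max 1 (max M1 (- M2))"
  have M: "M \<ge> 1" "M \<ge> M1" "- M \<le> M2" by (auto simp: M_def)
  have near_top: "\<bar>f y - \<sigma> * l\<bar> < d" if "\<sigma> * y \<ge> M" for y
    using \<sigma> that M M1[of y] M2[of y] by auto
  have near_bot: "\<bar>f y + \<sigma> * l\<bar> < d" if "\<sigma> * y \<le> - M" for y
    using \<sigma> that M M1[of y] M2[of y] by auto
  \<comment> \<open>If \<open>\<sigma> * v \<le> - M\<close>, then \<open>f v\<close> is replaced by
    its limit. Otherwise \<open>\<sigma> * u\<close> exceeds \<open>\<sigma> * v\<close> by
    \<open>2 / s \<ge> 2 * M\<close>, hence is at least \<open>M\<close>, and \<open>f u\<close> is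
    replaced. The condition \<open>s * M \<le> 2 - \<delta>\<close> excludes the second case when
    the second jump lies outside the interval.\<close>
  have upper: "(SUP x\<in>?I. ?h s x) \<le> Sup S + d"
    if s: "s > 0" and sM: "s * M \<le> 1" and s\<delta>: "\<delta> < 2 \<longrightarrow> s * M \<le> 2 - \<delta>" for s
  proof (rule cSUP_least)
    show "?I \<noteq> {}" using \<delta> by (auto intro!: exI[of _ "- \<sigma>"])
    fix x assume "x \<in> ?I"
    then have x: "\<bar>x + \<sigma>\<bar> \<le> \<delta>" by simp
    define u v where "u = (x + \<sigma>) / s" and "v = (x - \<sigma>) / s"
    have uv: "\<sigma> * u = \<sigma> * v + 2 / s"
      using s \<sigma>2 by (simp add: u_def v_def field_simps)
    show "?h s x \<le> Sup S + d"
    proof (cases "\<sigma> * v \<le> - M")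
      case True
      have "f u + \<sigma> * l \<le> Sup S"
        by (rule cSup_upper[OF _ S_bdd]) (simp add: S_def)
      then show ?thesis
        using near_bot[OF True] unfolding u_def[symmetric] v_def[symmetric] by linarith
    next
      case False
      have "M \<le> 1 / s" using s sM by (simp add: field_simps)
      then have "\<sigma> * u \<ge> M" using uv False by simp
      note nu = near_top[OF this]
      have "\<sigma> * (x + \<sigma>) \<le> \<delta>" using x \<sigma> by auto
      moreover have "\<sigma> * v * s = \<sigma> * (x + \<sigma>) - 2 * (\<sigma> * \<sigma>)"
        using s by (simp add: v_def right_diff_distrib distrib_left)
      ultimately have vs: "\<sigma> * v * s \<le> \<delta> - 2"
        unfolding \<sigma>2(1) by simp
      have "\<delta> > 2 \<or> \<delta> = 2 \<and> \<sigma> * v \<le> 0"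
      proof (cases "\<delta> < 2")
        case True
        have "\<sigma> * v * s > - M * s" using False s by (intro mult_strict_right_mono) auto
        then show ?thesis using vs s\<delta> True by (simp add: mult.commute)
      next
        case False
        then show ?thesis using vs s by (auto simp: mult_le_0_iff)
      qed
      then have "\<sigma> * l - f v \<le> Sup S"
        by (intro cSup_upper[OF _ S_bdd]) (auto simp: S_def)
      then show ?thesis
        using nu unfolding u_def[symmetric] v_def[symmetric] by linarith
    qed
  qed
  have eu: "\<forall>\<^sub>F s in at_right 0. (SUP x\<in>?I. ?h s x) \<le> Sup S + d"
  proof -
    define c where "c = (if \<delta> < 2 then min 1 (2 - \<delta>) else 1) / M"
    have "c > 0" using M by (auto simp: c_def)
    then have "\<forall>\<^sub>F s in at_right 0. s < c" by (auto simp: eventually_at_right)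
    then show ?thesis
      using eventually_at_right_less[of 0]
    proof eventually_elim
      case (elim s)
      then have "s * M < (if \<delta> < 2 then min 1 (2 - \<delta>) else 1)"
        using M by (simp add: c_def field_simps)
      then show ?case using elim by (intro upper) (auto split: if_splits)
    qed
  qed
  \<comment> \<open>For the lower bound a nearly maximal element of \<open>S\<close> suffices. Its
    scaled coordinate \<open>u\<close> or \<open>v\<close> is fixed, so for small \<open>s\<close>
    the corresponding \<open>x\<close> lies in the interval, and the other front is within
    \<open>d\<close> of its limit.\<close>
  obtain a where a: "a \<in> S" "a > Sup S - d"
    using less_cSup_iff[OF S_ne S_bdd, of "Sup S - d"] d by auto
  have el: "\<forall>\<^sub>F s in at_right 0. (SUP x\<in>?I. ?h s x) > a - d"
    using a(1) unfolding S_def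
  proof (elim UnE imageE)
    fix u assume a_eq: "a = f u + \<sigma> * l"
    have 1: "((\<lambda>s. \<bar>s * u\<bar>) \<longlongrightarrow> \<bar>0 * u\<bar>) (at_right 0)"
      and 2: "((\<lambda>s. s * (\<sigma> * u + M)) \<longlongrightarrow> 0 * (\<sigma> * u + M)) (at_right 0)"
      by (intro tendsto_intros)+
    have "\<forall>\<^sub>F s in at_right 0. \<bar>s * u\<bar> < \<delta>" "\<forall>\<^sub>F s in at_right 0. s * (\<sigma> * u + M) < 2"
      using \<delta> by (auto intro: order_tendstoD(2)[OF 1] order_tendstoD(2)[OF 2])
    then show ?thesis
      using eventually_at_right_less[of 0]
    proof eventually_elim
      case (elim s)
      define x where "x = s * u - \<sigma>"
      have "x \<in> ?I" using elim by (simp add: x_def)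
      then have "?h s x \<le> (SUP x\<in>?I. ?h s x)" by (intro cSUP_upper h_bdd)
      moreover have "(x + \<sigma>) / s = u" using elim by (simp add: x_def)
      moreover have "\<sigma> * ((x - \<sigma>) / s) \<le> - M"
        using elim \<sigma>2 by (simp add: x_def field_simps)
      note near_bot[OF this]
      ultimately show ?case unfolding a_eq by simp
    qed
  next
    fix v assume a_eq: "a = \<sigma> * l - f v" and v: "v \<in> {v. \<delta> > 2 \<or> \<delta> = 2 \<and> \<sigma> * v \<le> 0}"
    have 1: "((\<lambda>s. \<bar>2 * \<sigma> + s * v\<bar>) \<longlongrightarrow> \<bar>2 * \<sigma> + 0 * v\<bar>) (at_right 0)"
      and 2: "((\<lambda>s. s * (M - \<sigma> * v)) \<longlongrightarrow> 0 * (M - \<sigma> * v)) (at_right 0)"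
      and 3: "((\<lambda>s. s * (\<sigma> * v)) \<longlongrightarrow> 0 * (\<sigma> * v)) (at_right 0)"
      by (intro tendsto_intros)+
    have "\<forall>\<^sub>F s in at_right 0. \<delta> > 2 \<longrightarrow> \<bar>2 * \<sigma> + s * v\<bar> < \<delta>"
      using \<sigma>2 by (cases "\<delta> > 2") (auto simp: abs_mult intro: order_tendstoD(2)[OF 1])
    moreover have "\<forall>\<^sub>F s in at_right 0. s * (M - \<sigma> * v) < 2" "\<forall>\<^sub>F s in at_right 0. s * (\<sigma> * v) > - 2"
      by (auto intro: order_tendstoD(2)[OF 2] order_tendstoD(1)[OF 3])
    ultimately show ?thesis
      using eventually_at_right_less[of 0]
    proof eventually_elim
      case (elim s)
      define x where "x = s * v + \<sigma>"
      \<comment> \<open>The second jump has distance 2 from the centre of the interval. For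
        \<open>\<delta> = 2\<close> it is an endpoint: \<open>\<sigma> * v \<le> 0\<close> points
        inwards, and \<open>s * (\<sigma> * v) > - 2\<close> prevents leaving through the other
        end.\<close>
      have "x \<in> ?I"
      proof (cases "\<delta> > 2")
        case True
        then show ?thesis using elim by (simp add: x_def add.commute)
      next
        case False
        then have "\<delta> = 2" "s * (\<sigma> * v) \<le> 0" using v elim by (auto simp: mult_le_0_iff)
        then show ?thesis using elim \<sigma> by (auto simp: x_def)
      qed
      then have "?h s x \<le> (SUP x\<in>?I. ?h s x)" by (intro cSUP_upper h_bdd)
      moreover have "(x - \<sigma>) / s = v" using elim by (simp add: x_def)
      moreover have "\<sigma> * ((x + \<sigma>) / s) \<ge> M"
        using elim \<sigma>2 by (simp add: x_def field_simps)
      note near_top[OF this]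
      ultimately show ?case unfolding a_eq by simp
    qed
  qed
  show "\<forall>\<^sub>F s in at_right 0. dist (SUP x\<in>?I. ?h s x) (Sup S) < e"
    using eu el
  proof eventually_elim
    case (elim s)
    have "e = 3 * d" by (simp add: d_def)
    then show ?case using elim a(2) d unfolding dist_real_def by linarith
  qed
qed

section \<open>The iterated limits\<close>

text \<open>The factor \<open>c\<close> unifies four statements: 1 and -1 give the supremum and the
  negated infimum of the real part, \<open>- \<i>\<close> and \<open>\<i>\<close> those of the
  imaginary part. In the last two cases \<open>Re c = 0\<close>, and the limit vanishes.\<close>

lemma SUP_Re_solution_has_iterated_limit:
  assumes sol: "\<And>n. n \<ge> 2 \<Longrightarrow> L2_solution n box_datum (q n)"
    and \<delta>: "\<delta> > 0" and \<sigma>: "\<sigma> \<in> {1, -1}"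
  shows "has_iterated_limit (\<lambda>n t. SUP x\<in>{x. \<bar>x + \<sigma>\<bar> \<le> \<delta>}. Re (c * q n x t))
           (Re c / 2 + \<bar>Re c\<bar> * (Si pi / pi))"
proof -
  let ?I = "{x. \<bar>x + \<sigma>\<bar> \<le> \<delta>}"
  \<comment> \<open>Exchanging the two jumps reverses the sign of the difference of fronts. The
    factor \<sigma> compensates for this, so that the jump at \<open>- \<sigma>\<close> always comes
    first.\<close>
  define f where "f n y = \<sigma> * Re (c * front n y)" for n y
  define S where "S n = range (\<lambda>u. f n u + Re c / 2) \<union>
      (\<lambda>v. Re c / 2 - f n v) ` {v. \<delta> > 2 \<or> \<delta> = 2 \<and> \<sigma> * v \<le> 0}" for n
  define l where "l = \<sigma> * (Re c / 2)"
  have \<sigma>l: "\<sigma> * l = Re c / 2" and abs_\<sigma>: "\<bar>\<sigma>\<bar> = 1" using \<sigma> by (auto simp: l_def)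
  have near: "\<bar>f n y - \<sigma> * Re c * (Si y / pi)\<bar> \<le> cmod c * (6 / real n)" if n: "n \<ge> 2" for n y
  proof -
    have "f n y - \<sigma> * Re c * (Si y / pi) = \<sigma> * Re (c * (front n y - of_real (Si y / pi)))"
      by (simp add: f_def right_diff_distrib)
    then have "\<bar>f n y - \<sigma> * Re c * (Si y / pi)\<bar> = \<bar>Re (c * (front n y - of_real (Si y / pi)))\<bar>"
      by (simp only: abs_mult abs_\<sigma> mult_1)
    also have "\<dots> \<le> cmod (c * (front n y - of_real (Si y / pi)))"
      by (rule abs_Re_le_cmod)
    also have "\<dots> \<le> cmod c * (6 / real n)"
      unfolding norm_mult by (intro mult_left_mono norm_front_minus_Si_le n) simp
    finally show ?thesis .
  qed
  have Si_le: "\<bar>\<sigma> * Re c * (Si y / pi)\<bar> \<le> \<bar>Re c\<bar> * (Si pi / pi)" for y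
    using abs_\<sigma> abs_Si_le[of y] by (simp add: abs_mult mult_left_mono divide_right_mono)
  have "((\<lambda>t. SUP x\<in>?I. Re (c * q n x t)) \<longlongrightarrow> Sup (S n)) (at_right 0)" if n: "n \<ge> 2" for n
  proof -
    have "((\<lambda>y. \<sigma> * Re (c * front n y)) \<longlongrightarrow> \<sigma> * Re (c * (1 / 2))) at_top"
      "((\<lambda>y. \<sigma> * Re (c * front n y)) \<longlongrightarrow> \<sigma> * Re (c * - (1 / 2))) at_bot"
      by (intro tendsto_intros front_at_top front_at_bot n)+
    then have lim: "(f n \<longlongrightarrow> l) at_top" "(f n \<longlongrightarrow> - l) at_bot"
      by (simp_all add: f_def[abs_def] l_def)
    have bound: "\<bar>f n y\<bar> \<le> \<bar>Re c\<bar> * (Si pi / pi) + cmod c * (6 / real n)" for y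
      using near[OF n, of y] Si_le[of y] by linarith
    have root: "filterlim (root n) (at_right 0) (at_right 0)"
      unfolding filterlim_at
    proof
      show "(root n \<longlongrightarrow> 0) (at_right 0)"
        using tendsto_real_root[OF tendsto_ident_at[of 0 "{0<..}"], of n] by simp
      show "\<forall>\<^sub>F x in at_right 0. root n x \<in> {0<..} \<and> root n x \<noteq> 0"
        using eventually_at_right_less[of 0] by eventually_elim (use n in simp)
    qed
    have "((\<lambda>t. SUP x\<in>?I. f n ((x + \<sigma>) / root n t) - f n ((x - \<sigma>) / root n t)) \<longlongrightarrow> Sup (S n)) (at_right 0)"
      using filterlim_compose[OF SUP_front_difference_tendsto[OF lim bound \<sigma> \<delta>] root]
      by (simp add: S_def \<sigma>l)
    moreover have "\<forall>\<^sub>F t in at_right 0. (SUP x\<in>?I. f n ((x + \<sigma>) / root n t) - f n ((x - \<sigma>) / root n t)) =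
        (SUP x\<in>?I. Re (c * q n x t))"
      using eventually_at_right_less[of 0]
    proof eventually_elim
      case (elim t)
      have "f n ((x + \<sigma>) / root n t) - f n ((x - \<sigma>) / root n t) = Re (c * q n x t)" for x
        using \<sigma> unfolding L2_solution_eq[OF n elim sol[OF n]] f_def
        by (auto simp: algebra_simps)
      then show ?case by simp
    qed
    ultimately show ?thesis by (rule Lim_transform_eventually)
  qed
  moreover have "(\<lambda>n. Sup (S n)) \<longlonglongrightarrow> Re c / 2 + \<bar>Re c\<bar> * (Si pi / pi)" (is "_ \<longlonglongrightarrow> ?L")
  proof -
    have "norm (Sup (S n) - ?L) \<le> cmod c * (6 / real n)" if n: "n \<ge> 2" for n
    proof -
      \<comment> \<open>Elements from either jump obey the same upper bound, and the first jump
        alone nearly attains it. Hence the outer limit does not depend on \<delta>.\<close>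
      have le: "a \<le> ?L + cmod c * (6 / real n)" if aS: "a \<in> S n" for a
      proof -
        obtain y where "a = f n y + Re c / 2 \<or> a = Re c / 2 - f n y"
          using aS unfolding S_def by blast
        then show ?thesis using near[OF n, of y] Si_le[of y] by linarith
      qed
      then have "Sup (S n) \<le> ?L + cmod c * (6 / real n)"
        by (intro cSup_least) (auto simp: S_def)
      moreover have "?L - cmod c * (6 / real n) \<le> Sup (S n)"
      proof -
        \<comment> \<open>The sign is chosen so that the odd function \<open>Si\<close> contributes
          its maximal value \<open>\<bar>Re c\<bar> * (Si pi / pi)\<close>.\<close>
        define y where "y = (if \<sigma> * Re c \<ge> 0 then pi else - pi)"
        have "\<sigma> * Re c * (Si y / pi) = \<bar>\<sigma> * Re c\<bar> * (Si pi / pi)"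
          by (simp add: y_def Si_minus)
        then have "\<sigma> * Re c * (Si y / pi) = \<bar>Re c\<bar> * (Si pi / pi)"
          using abs_\<sigma> by (simp add: abs_mult)
        then have "?L - cmod c * (6 / real n) \<le> f n y + Re c / 2"
          using near[OF n, of y] by linarith
        also have "\<dots> \<le> Sup (S n)"
        proof (rule cSup_upper)
          show "bdd_above (S n)" using le by (rule bdd_aboveI)
        qed (simp add: S_def)
        finally show ?thesis .
      qed
      ultimately show ?thesis unfolding real_norm_def by linarith
    qed
    then have "\<forall>\<^sub>F n in sequentially. norm (Sup (S n) - ?L) \<le> cmod c * (6 / real n)"
      by (auto simp: eventually_sequentially)
    moreover have "(\<lambda>n. cmod c * (6 / real n)) \<longlonglongrightarrow> 0"
      by (intro tendsto_mult_right_zero lim_const_over_n)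
    ultimately have "(\<lambda>n. Sup (S n) - ?L) \<longlonglongrightarrow> 0"
      by (rule Lim_null_comparison)
    then show ?thesis
      by (rule Lim_null[THEN iffD2])
  qed
  ultimately show ?thesis
    unfolding has_iterated_limit_def by (intro exI[of _ "\<lambda>n. Sup (S n)"]) simp
qed

lemma has_iterated_limit_uminus:
  assumes "has_iterated_limit F l"
  shows "has_iterated_limit (\<lambda>n t. - F n t) (- l)"
proof -
  obtain L where "\<forall>n\<ge>2. (F n \<longlongrightarrow> L n) (at_right 0)" "L \<longlonglongrightarrow> l"
    using assms by (auto simp: has_iterated_limit_def)
  then show ?thesis
    unfolding has_iterated_limit_def by (intro exI[of _ "\<lambda>n. - L n"]) (auto intro: tendsto_minus)
qed

lemma INF_eq_uminus_SUP_real: "(INF x\<in>A. f x :: real) = - (SUP x\<in>A. - f x)"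
  by (simp add: Inf_real_def image_image)

theorem mainTheorem5:
  fixes q :: "nat \<Rightarrow> real \<Rightarrow> real \<Rightarrow> complex" and \<delta> \<sigma> :: real
  assumes "\<And>n. n \<ge> 2 \<Longrightarrow> L2_solution n box_datum (q n)"
    and "\<delta> > 0"
    and "\<sigma> \<in> {1, -1}"
  shows
   "has_iterated_limit (\<lambda>n t. SUP x\<in>{x. \<bar>x + \<sigma>\<bar> \<le> \<delta>}. Re (q n x t)) (1 + gibbs_constant) \<and>
    has_iterated_limit (\<lambda>n t. INF x\<in>{x. \<bar>x + \<sigma>\<bar> \<le> \<delta>}. Re (q n x t)) (- gibbs_constant) \<and>
    has_iterated_limit (\<lambda>n t. SUP x\<in>{x. \<bar>x + \<sigma>\<bar> \<le> \<delta>}. Im (q n x t)) 0 \<and>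
    has_iterated_limit (\<lambda>n t. INF x\<in>{x. \<bar>x + \<sigma>\<bar> \<le> \<delta>}. Im (q n x t)) 0"
proof -
  note SUP = SUP_Re_solution_has_iterated_limit[OF assms]
  have gibbs: "gibbs_constant = Si pi / pi - 1 / 2"
    by (simp add: gibbs_constant_def Si_def)
  have "has_iterated_limit (\<lambda>n t. SUP x\<in>{x. \<bar>x + \<sigma>\<bar> \<le> \<delta>}. Re (q n x t)) (1 + gibbs_constant)"
    using SUP[of 1] by (simp add: gibbs)
  moreover have "has_iterated_limit (\<lambda>n t. INF x\<in>{x. \<bar>x + \<sigma>\<bar> \<le> \<delta>}. Re (q n x t)) (- gibbs_constant)"
    using has_iterated_limit_uminus[OF SUP[of "-1"]] by (simp add: gibbs INF_eq_uminus_SUP_real)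
  moreover have "has_iterated_limit (\<lambda>n t. SUP x\<in>{x. \<bar>x + \<sigma>\<bar> \<le> \<delta>}. Im (q n x t)) 0"
    using SUP[of "- \<i>"] by simp
  moreover have "has_iterated_limit (\<lambda>n t. INF x\<in>{x. \<bar>x + \<sigma>\<bar> \<le> \<delta>}. Im (q n x t)) 0"
    using has_iterated_limit_uminus[OF SUP[of "\<i>"]] by (simp add: INF_eq_uminus_SUP_real)
  ultimately show ?thesis by blast
qed

end
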